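(* Let $\{\omega_t^s\}$ be produced by the R-SVRG/R-SRG variant of Algorithm 1 (described in the context) with option 2 (output $\omega_a$ drawn uniformly at random from $\{\omega_t^s:0\le t\le m-1,\ 1\le s\le S\}$). Assume: (i) $f$ and each $f_i$ are continuously differentiable; (ii) all iterates stay in a compact neighbourhood $\Omega$ of $\omega^*$; there is $\rho>0$ such that for every $\omega\in\Omega$, with $B(0_\omega,\rho)\subset T_\omega\mathcal M$ the ball of radius $\rho$ centred at $0_\omega$, $R_\omega$ is a diffeomorphism on $B(0_\omega,\rho)$ and $\Omega\subset R_\omega(B(0_\omega,\rho))$; and $R_{\omega_t^s}(-\tau\alpha_t^sV_t^s)\in\Omega$ for all $t\ge0$, $s\ge1$, $\tau\in[0,1]$; (iii) $\mathcal T$ is continuous and isometric: $\langle\mathcal T_\eta\xi,\mathcal T_\eta\zeta\rangle=\langle\xi,\zeta\rangle$ for all $\eta,\xi,\zeta\in T_\omega\mathcal M$, $\omega\in\mathcal M$; (iv) there is $M>0$ with $\frac1n\sum_{i=1}^n\|\mathrm{grad}f_i(x)-\Gamma_y^x\mathrm{grad}f_i(y)\|^2\le M^2\|\xi\|^2$ for all $x,y=R_x(\xi)\in\Omega$; (v) there is $\theta>0$ with $\|\Gamma_x^y\eta-\mathcal T_x^y\eta\|\le\theta\|\xi\|\|\eta\|$ for all $x,y=R_x(\xi)\in\Omega$, $\eta\in T_x\mathcal M$; (vi) there is $L>0$ with $f(y)\le f(x)+\langle\mathrm{grad}f(x),\xi\rangle+\frac L2\|\xi\|^2$ for all $x,y=R_x(\xi)\in\Omega$;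 (vii) there are $C_1,C_2>0$ and $\delta_{C_1,C_2}>0$ such that for all $x,y=R_x(\xi)\in\Omega$ with $\|\xi\|\le\delta_{C_1,C_2}$: $\|\xi\|\le C_1d(x,y)$ and $d(x,y)\le C_2\|\xi\|$. Let $N>0$ satisfy $\|\mathrm{grad}f_i(\omega)\|\le N$ for all $\omega\in\Omega$ and all $i$. Let $\alpha_t^s\equiv C_\alpha$ with $C_\alpha\le\frac{1}{L+\sqrt{L^2+4\nu}}$, where $\nu=4m^3(M^2+\theta^2N^2)C_1^2C_2^2$, and suppose $\sum_{s=1}^\infty\sum_{t=0}^{m-1}(\psi_t^s)^2<\infty$. Then $$\mathbb E[\|\mathrm{grad}f(\omega_a)\|^2]\le\frac{2}{mSC_\alpha}\mathbb E[f(\tilde\omega^0)-f(\omega^* )]+\frac{8N^2}{S}\sum_{s=1}^\infty\sum_{t=0}^{m-1}(\psi_t^s)^2=\mathcal O\Big(\frac1S\Big).$$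
   Context: $\mathcal M$ is a smooth Riemannian manifold with metric $\langle\cdot,\cdot\rangle$, induced norm $\|\cdot\|$ on tangent spaces, and Riemannian distance $d$. $f_1,\dots,f_n:\mathcal M\to\mathbb R$ and $f=\frac1n\sum_{i=1}^n f_i$; $\mathrm{grad}$ is the Riemannian gradient; $\omega^*$ is a global minimizer of $f$. $R:T\mathcal M\to\mathcal M$ is a retraction: its restriction $R_\omega$ to $T_\omega\mathcal M$ satisfies $R_\omega(0_\omega)=\omega$ and $DR_\omega(0_\omega)[\xi]=\xi$. $\mathcal T$ is a vector transport: a smooth map $(\eta_\omega,\xi_\omega)\mapsto\mathcal T_{\eta_\omega}(\xi_\omega)\in T_{R_\omega(\eta_\omega)}\mathcal M$, linear in $\xi_\omega$, with $\mathcal T_{0_\omega}\xi=\xi$. One writes $\mathcal T_\omega^{R_\omega(\eta)}:=\mathcal T_\eta$ for $\eta \in T_\omega\mathcal M$. $\Gamma_x^y:T_x\mathcal M\to T_y\mathcal M$ is the parallel translation along the geodesic (exponential mapping) linking $x$ and $y$. R-SVRG/R-SRG variant of Algorithm 1. Input: step sizes $\alpha_t^s>0$, an integer $m\ge1$, a constant $0<\mu<1$, parameters $0\le\psi_t^s\le1$, and an initial point $\tilde\omega^0$. For $s=1,2,\dots,S$: set $\omega_0^s=\tilde\omega^{s-1}$, $V_0^s=\mathrm{grad}f(\omega_0^s)$, $\omega_1^s=R_{\omega_0^s}(-\alpha_0^sV_0^s)$. For $t=1,\dots,m-1$: choose an index set $I_t^s\subset\{1,\dots,n\}$ of given cardinality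 $b$ uniformly at random (independently of the past) and write $\mathrm{grad}f_{I_t^s}=\frac1{|I_t^s|}\sum_{i\in I_t^s}\mathrm{grad}f_i$; let $D_t^s=\langle\mathcal T_{\omega_{t-1}^s}^{\omega_t^s}(V_{t-1}^s-\mathrm{grad}f(\omega_{t-1}^s)),\mathrm{grad}f(\omega_t^s)\rangle$; put $\tilde\psi_t^s=\min\{\psi_t^s,\ \mu\|\mathrm{grad}f(\omega_t^s)\|^2/|D_t^s|\}$ if $D_t^s\ne0$ and $\tilde\psi_t^s=\psi_t^s$ otherwise, and $\tilde\phi_t^s=1-\tilde\psi_t^s$; set $$V_t^s=\tilde\phi_t^s\big(\mathrm{grad}f_{I_t^s}(\omega_t^s)-\mathcal T_{\omega_0^s}^{\omega_t^s}(\mathrm{grad}f_{I_t^s}(\omega_0^s)-\mathrm{grad}f(\omega_0^s))\big)+\tilde\psi_t^s\big(\mathrm{grad}f_{I_t^s}(\omega_t^s)-\mathcal T_{\omega_{t-1}^s}^{\omega_t^s}(\mathrm{grad}f_{I_t^s}(\omega_{t-1}^s)-V_{t-1}^s)\big)$$ and $\omega_{t+1}^s=R_{\omega_t^s}(-\alpha_t^sV_t^s)$. Then $\tilde\omega^s=\omega_m^s$. The $\mathcal O$ is as $S\to\infty$ with all other quantities fixed.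
   Formalization: Added assumption: Ω is small enough that ‖R_x^{-1}(y)‖ ≤ δ_{C1,C2} for all x,y∈Ω (inverse on B(0_x,ρ)), so that (vii) applies to all pairs of points of Ω; with (vii) read literally, for an unrelated small δ, the bound can fail. *)

theory Defs
  imports "HOL-Probability.Probability" "HOL-Library.Landau_Symbols"
begin

section \<open>Functions of class C^k on open subsets of normed spaces\<close>

primrec Ck_on :: "nat \<Rightarrow> ('a::real_normed_vector \<Rightarrow> 'b::real_normed_vector) \<Rightarrow> 'a set \<Rightarrow> bool" where
  "Ck_on 0 f S \<longleftrightarrow> continuous_on S f"
| "Ck_on (Suc k) f S \<longleftrightarrow>
     (\<forall>x\<in>S. f differentiable (at x)) \<and> (\<forall>v. Ck_on k (\<lambda>x. frechet_derivative f (at x) v) S)"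

definition smooth_on :: "('a::real_normed_vector \<Rightarrow> 'b::real_normed_vector) \<Rightarrow> 'a set \<Rightarrow> bool" where
  "smooth_on f S \<longleftrightarrow> (\<forall>k. Ck_on k f S)"


section \<open>Smooth Riemannian manifolds\<close>

text \<open>
  The manifold is a Hausdorff second countable type \<open>'m\<close> with a smooth atlas modelled on a Euclidean
  space \<open>'e\<close>.  Every point \<open>x\<close> has a preferred chart \<open>chart_at x\<close> of the atlas, and the tangent
  space at \<open>x\<close> is the vector space \<open>'e\<close>, a tangent vector being identified with its coordinates in
  \<open>chart_at x\<close>.  So a map from the tangent bundle has type \<open>'m \<Rightarrow> 'e \<Rightarrow> _\<close>, and \<open>metric x\<close> is the inner
  product of the tangent space at \<open>x\<close> (in general not the one of \<open>'e\<close>).  The preferred charts may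
  depend discontinuously on \<open>x\<close>; all regularity notions below are therefore stated in a fixed chart,
  where tangent vectors are transformed by the derivative of the change of coordinates.
\<close>

type_synonym ('m, 'e) chart = "'m set \<times> ('m \<Rightarrow> 'e)"

record ('m, 'e) riem =
  atlas :: "('m, 'e) chart set"
  chart_at :: "'m \<Rightarrow> ('m, 'e) chart"
  metric :: "'m \<Rightarrow> 'e \<Rightarrow> 'e \<Rightarrow> real"

abbreviation cdom :: "('m, 'e) chart \<Rightarrow> 'm set" where "cdom \<equiv> fst"
abbreviation cmap :: "('m, 'e) chart \<Rightarrow> 'm \<Rightarrow> 'e" where "cmap \<equiv> snd"
abbreviation crange :: "('m, 'e) chart \<Rightarrow> 'e set" where "crange c \<equiv> cmap c ` cdom c"
definition cinv :: "('m, 'e) chart \<Rightarrow> 'e \<Rightarrow> 'm" where "cinv c = inv_into (cdom c) (cmap c)"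

text \<open>
  \<open>tcoord X c x v\<close> is the coordinate vector in the chart \<open>c\<close> of the tangent vector \<open>v\<close> at \<open>x\<close>;
  conversely \<open>tvec X c u a\<close> is the tangent vector at the point with coordinates \<open>u\<close> in \<open>c\<close> whose
  coordinate vector in \<open>c\<close> is \<open>a\<close>.
\<close>

definition tcoord ::
  "('m, 'e::euclidean_space) riem \<Rightarrow> ('m, 'e) chart \<Rightarrow> 'm \<Rightarrow> 'e \<Rightarrow> 'e" where
  "tcoord X c x v =
     frechet_derivative (cmap c \<circ> cinv (chart_at X x)) (at (cmap (chart_at X x) x)) v"

definition tvec ::
  "('m, 'e::euclidean_space) riem \<Rightarrow> ('m, 'e) chart \<Rightarrow> 'e \<Rightarrow> 'e \<Rightarrow> 'e" where
  "tvec X c u a = frechet_derivative (cmap (chart_at X (cinv c u)) \<circ> cinv c) (at u) a"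

definition metric_in ::
  "('m, 'e::euclidean_space) riem \<Rightarrow> ('m, 'e) chart \<Rightarrow> 'e \<Rightarrow> 'e \<Rightarrow> 'e \<Rightarrow> real" where
  "metric_in X c u a b = metric X (cinv c u) (tvec X c u a) (tvec X c u b)"

definition riemannian_manifold ::
  "('m::{t2_space, second_countable_topology}, 'e::euclidean_space) riem \<Rightarrow> bool" where
  "riemannian_manifold X \<longleftrightarrow>
     (\<forall>c\<in>atlas X. open (cdom c) \<and> open (crange c) \<and>
        homeomorphism (cdom c) (crange c) (cmap c) (cinv c)) \<and>
     (\<forall>c\<in>atlas X. \<forall>d\<in>atlas X. smooth_on (cmap d \<circ> cinv c) (cmap c ` (cdom c \<inter> cdom d))) \<and>
     (\<forall>x. chart_at X x \<in> atlas X \<and> x \<in> cdom (chart_at X x)) \<and>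
     (\<forall>x. bilinear (metric X x) \<and> (\<forall>v w. metric X x v w = metric X x w v) \<and>
        (\<forall>v. v \<noteq> 0 \<longrightarrow> metric X x v v > 0)) \<and>
     (\<forall>c\<in>atlas X. \<forall>a b. smooth_on (\<lambda>u. metric_in X c u a b) (crange c))"

definition tnorm :: "('m, 'e) riem \<Rightarrow> 'm \<Rightarrow> 'e \<Rightarrow> real" where
  "tnorm X x v = sqrt (metric X x v v)"

definition tball :: "('m, 'e) riem \<Rightarrow> 'm \<Rightarrow> real \<Rightarrow> 'e set" where
  "tball X x r = {v. tnorm X x v < r}"

definition C1_fun :: "('m, 'e::euclidean_space) riem \<Rightarrow> ('m \<Rightarrow> real) \<Rightarrow> bool" where
  "C1_fun X h \<longleftrightarrow> (\<forall>c\<in>atlas X. Ck_on 1 (h \<circ> cinv c) (crange c))"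

definition grad :: "('m, 'e::euclidean_space) riem \<Rightarrow> ('m \<Rightarrow> real) \<Rightarrow> 'm \<Rightarrow> 'e" where
  "grad X h x = (THE v. \<forall>w. metric X x v w =
     frechet_derivative (h \<circ> cinv (chart_at X x)) (at (cmap (chart_at X x) x)) w)"


subsection \<open>Curves and the Riemannian distance\<close>

definition velocity ::
  "('m, 'e::euclidean_space) riem \<Rightarrow> (real \<Rightarrow> 'm) \<Rightarrow> real \<Rightarrow> 'e" where
  "velocity X \<gamma> t = vector_derivative (cmap (chart_at X (\<gamma> t)) \<circ> \<gamma>) (at t within {0..1})"

definition C1_curve ::
  "('m::topological_space, 'e::euclidean_space) riem \<Rightarrow> (real \<Rightarrow> 'm) \<Rightarrow> bool" where
  "C1_curve X \<gamma> \<longleftrightarrow> continuous_on {0..1} \<gamma> \<and>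
     (\<forall>c\<in>atlas X.
        (\<forall>t\<in>{0..1}. \<gamma> t \<in> cdom c \<longrightarrow> (cmap c \<circ> \<gamma>) differentiable (at t within {0..1})) \<and>
        continuous_on {t\<in>{0..1}. \<gamma> t \<in> cdom c}
          (\<lambda>t. vector_derivative (cmap c \<circ> \<gamma>) (at t within {0..1})))"

definition curve_length ::
  "('m, 'e::euclidean_space) riem \<Rightarrow> (real \<Rightarrow> 'm) \<Rightarrow> real" where
  "curve_length X \<gamma> = integral {0..1} (\<lambda>t. tnorm X (\<gamma> t) (velocity X \<gamma> t))"

text \<open>
  \<open>pw_C1_path X x y l\<close>: some piecewise C^1 curve from \<open>x\<close> to \<open>y\<close>, i.e. a finite concatenation of
  C^1 curves, has length \<open>l\<close>.
\<close>

inductive pw_C1_path ::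
  "('m::topological_space, 'e::euclidean_space) riem \<Rightarrow> 'm \<Rightarrow> 'm \<Rightarrow> real \<Rightarrow> bool"
  for X where
  "pw_C1_path X x x 0"
| "\<lbrakk>C1_curve X \<gamma>; pw_C1_path X (\<gamma> 1) z l\<rbrakk> \<Longrightarrow> pw_C1_path X (\<gamma> 0) z (curve_length X \<gamma> + l)"

text \<open>The distance between points of different connected components is infinite.\<close>

definition rdist ::
  "('m::topological_space, 'e::euclidean_space) riem \<Rightarrow> 'm \<Rightarrow> 'm \<Rightarrow> ennreal" where
  "rdist X x y = (INF l\<in>{l. pw_C1_path X x y l}. ennreal l)"


subsection \<open>Parallel translation along geodesics\<close>

text \<open>
  In the coordinates of the chart \<open>c\<close>, the Christoffel symbols of the first kind of the Levi-Civita
  connection, as a trilinear form: \<open>christoffel X c u a b z\<close> is the sum of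
  \<open>a\<^sup>i b\<^sup>j z\<^sup>k (\<partial>\<^sub>i g\<^sub>j\<^sub>k + \<partial>\<^sub>j g\<^sub>i\<^sub>k - \<partial>\<^sub>k g\<^sub>i\<^sub>j) / 2\<close>.
\<close>

definition christoffel ::
  "('m, 'e::euclidean_space) riem \<Rightarrow> ('m, 'e) chart \<Rightarrow> 'e \<Rightarrow> 'e \<Rightarrow> 'e \<Rightarrow> 'e \<Rightarrow> real" where
  "christoffel X c u a b z =
     (frechet_derivative (\<lambda>u. metric_in X c u b z) (at u) a
      + frechet_derivative (\<lambda>u. metric_in X c u a z) (at u) b
      - frechet_derivative (\<lambda>u. metric_in X c u a b) (at u) z) / 2"

text \<open>
  The vector field \<open>Y\<close> along \<open>\<gamma>\<close> is parallel if its covariant derivative vanishes: in every chart, with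
  \<open>a\<close> and \<open>Y'\<close> the derivatives of the coordinates of \<open>\<gamma>\<close> and \<open>Y\<close>, the inner product of the covariant
  derivative with each \<open>z\<close> is the left-hand side of the equation below.
\<close>

definition parallel_along ::
  "('m::topological_space, 'e::euclidean_space) riem \<Rightarrow> (real \<Rightarrow> 'm) \<Rightarrow> (real \<Rightarrow> 'e) \<Rightarrow> bool" where
  "parallel_along X \<gamma> Y \<longleftrightarrow> continuous_on {0..1} \<gamma> \<and>
     (\<forall>c\<in>atlas X. \<forall>t\<in>{0..1}. \<gamma> t \<in> cdom c \<longrightarrow>
        (\<exists>a Y'. ((\<lambda>s. cmap c (\<gamma> s)) has_vector_derivative a) (at t within {0..1}) \<and>
           ((\<lambda>s. tcoord X c (\<gamma> s) (Y s)) has_vector_derivative Y') (at t within {0..1}) \<and>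
           (\<forall>z. metric_in X c (cmap c (\<gamma> t)) Y' z
              + christoffel X c (cmap c (\<gamma> t)) a (tcoord X c (\<gamma> t) (Y t)) z = 0)))"

definition geodesic ::
  "('m::topological_space, 'e::euclidean_space) riem \<Rightarrow> (real \<Rightarrow> 'm) \<Rightarrow> bool" where
  "geodesic X \<gamma> \<longleftrightarrow> parallel_along X \<gamma> (velocity X \<gamma>)"

definition parallel_translates ::
  "('m::topological_space, 'e::euclidean_space) riem \<Rightarrow> (real \<Rightarrow> 'm) \<Rightarrow> 'e \<Rightarrow> 'e \<Rightarrow> bool" where
  "parallel_translates X \<gamma> v w \<longleftrightarrow> (\<exists>Y. parallel_along X \<gamma> Y \<and> Y 0 = v \<and> Y 1 = w)"

text \<open>
  A geodesic linking two given points need not be unique.  \<open>\<Gamma>\<close> is the parallel translation along some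
  choice of geodesics linking the points of \<open>\<Omega>\<close>, the same geodesic serving for \<open>\<Gamma> x y\<close> and,
  backwards, for \<open>\<Gamma> y x\<close>.
\<close>

definition parallel_translation_on ::
  "('m::topological_space, 'e::euclidean_space) riem \<Rightarrow> 'm set \<Rightarrow> ('m \<Rightarrow> 'm \<Rightarrow> 'e \<Rightarrow> 'e) \<Rightarrow> bool" where
  "parallel_translation_on X \<Omega> \<Gamma> \<longleftrightarrow>
     (\<forall>x\<in>\<Omega>. \<forall>y\<in>\<Omega>. \<exists>\<gamma>. geodesic X \<gamma> \<and> \<gamma> 0 = x \<and> \<gamma> 1 = y \<and>
        (\<forall>v. parallel_translates X \<gamma> v (\<Gamma> x y v)) \<and>
        (\<forall>w. parallel_translates X \<gamma> (\<Gamma> y x w) w))"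


subsection \<open>Retractions and vector transports\<close>

text \<open>
  The set of \<open>(u, a)\<close> such that the tangent vector with coordinates \<open>(u, a)\<close> in the chart \<open>c\<close> is mapped
  by \<open>R\<close> into the domain of the chart \<open>d\<close>.
\<close>

definition retr_dom ::
  "('m, 'e::euclidean_space) riem \<Rightarrow> ('m \<Rightarrow> 'e \<Rightarrow> 'm) \<Rightarrow> ('m, 'e) chart \<Rightarrow> ('m, 'e) chart \<Rightarrow>
   ('e \<times> 'e) set" where
  "retr_dom X R c d = {(u, a). u \<in> crange c \<and> R (cinv c u) (tvec X c u a) \<in> cdom d}"

definition riemannian_retraction ::
  "('m, 'e::euclidean_space) riem \<Rightarrow> ('m \<Rightarrow> 'e \<Rightarrow> 'm) \<Rightarrow> bool" where
  "riemannian_retraction X R \<longleftrightarrow>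
     (\<forall>c\<in>atlas X. \<forall>d\<in>atlas X. open (retr_dom X R c d) \<and>
        smooth_on (\<lambda>(u, a). cmap d (R (cinv c u) (tvec X c u a))) (retr_dom X R c d)) \<and>
     (\<forall>x. R x 0 = x) \<and>
     (\<forall>x. ((\<lambda>\<xi>. cmap (chart_at X x) (R x \<xi>)) has_derivative (\<lambda>\<xi>. \<xi>)) (at 0))"

text \<open>\<open>T x \<eta> \<xi>\<close> is the transport of \<open>\<xi>\<close> along \<open>\<eta>\<close>, a tangent vector at \<open>R x \<eta>\<close>.\<close>

definition transport_Ck ::
  "nat \<Rightarrow> ('m, 'e::euclidean_space) riem \<Rightarrow> ('m \<Rightarrow> 'e \<Rightarrow> 'm) \<Rightarrow> ('m \<Rightarrow> 'e \<Rightarrow> 'e \<Rightarrow> 'e) \<Rightarrow> bool" where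
  "transport_Ck k X R T \<longleftrightarrow>
     (\<forall>c\<in>atlas X. \<forall>d\<in>atlas X.
        Ck_on k (\<lambda>(u, a, b). tcoord X d (R (cinv c u) (tvec X c u a))
                   (T (cinv c u) (tvec X c u a) (tvec X c u b)))
          {(u, a, b). (u, a) \<in> retr_dom X R c d})"

definition vector_transport ::
  "('m, 'e::euclidean_space) riem \<Rightarrow> ('m \<Rightarrow> 'e \<Rightarrow> 'm) \<Rightarrow> ('m \<Rightarrow> 'e \<Rightarrow> 'e \<Rightarrow> 'e) \<Rightarrow> bool" where
  "vector_transport X R T \<longleftrightarrow>
     (\<forall>k. transport_Ck k X R T) \<and> (\<forall>x \<eta>. linear (T x \<eta>)) \<and> (\<forall>x \<xi>. T x 0 \<xi> = \<xi>)"

definition continuous_transport ::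
  "('m, 'e::euclidean_space) riem \<Rightarrow> ('m \<Rightarrow> 'e \<Rightarrow> 'm) \<Rightarrow> ('m \<Rightarrow> 'e \<Rightarrow> 'e \<Rightarrow> 'e) \<Rightarrow> bool" where
  "continuous_transport X R T \<longleftrightarrow> transport_Ck 0 X R T"

definition isometric_transport ::
  "('m, 'e) riem \<Rightarrow> ('m \<Rightarrow> 'e \<Rightarrow> 'm) \<Rightarrow> ('m \<Rightarrow> 'e \<Rightarrow> 'e \<Rightarrow> 'e) \<Rightarrow> bool" where
  "isometric_transport X R T \<longleftrightarrow>
     (\<forall>x \<eta> \<xi> \<zeta>. metric X (R x \<eta>) (T x \<eta> \<xi>) (T x \<eta> \<zeta>) = metric X x \<xi> \<zeta>)"

definition retr_inv ::
  "('m, 'e) riem \<Rightarrow> ('m \<Rightarrow> 'e \<Rightarrow> 'm) \<Rightarrow> real \<Rightarrow> 'm \<Rightarrow> 'm \<Rightarrow> 'e" where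
  "retr_inv X R \<rho> x = inv_into (tball X x \<rho>) (R x)"

definition diffeo_on_tball ::
  "('m::topological_space, 'e::euclidean_space) riem \<Rightarrow> ('m \<Rightarrow> 'e \<Rightarrow> 'm) \<Rightarrow> real \<Rightarrow> 'm \<Rightarrow> bool" where
  "diffeo_on_tball X R \<rho> x \<longleftrightarrow>
     inj_on (R x) (tball X x \<rho>) \<and> open (R x ` tball X x \<rho>) \<and>
     (\<forall>c\<in>atlas X.
        smooth_on (cmap c \<circ> R x) {\<xi> \<in> tball X x \<rho>. R x \<xi> \<in> cdom c} \<and>
        smooth_on (retr_inv X R \<rho> x \<circ> cinv c) (cmap c ` (cdom c \<inter> R x ` tball X x \<rho>)))"


section \<open>The R-SVRG/R-SRG algorithm\<close>

definition minibatches :: "nat \<Rightarrow> nat \<Rightarrow> nat set set" where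
  "minibatches n b = {I. I \<subseteq> {1..n} \<and> card I = b}"

text \<open>
  \<open>J (s, t)\<close> is the index set drawn in step \<open>t\<close> of epoch \<open>s\<close>, so a family \<open>J\<close> determines a run; \<open>w0\<close> is
  the initial point.
\<close>

context
  fixes X :: "('m, 'e::euclidean_space) riem"
    and R :: "'m \<Rightarrow> 'e \<Rightarrow> 'm" and T :: "'m \<Rightarrow> 'e \<Rightarrow> 'e \<Rightarrow> 'e" and \<rho> :: real
    and f :: "'m \<Rightarrow> real" and fi :: "nat \<Rightarrow> 'm \<Rightarrow> real"
    and \<alpha> :: "nat \<Rightarrow> nat \<Rightarrow> real" and \<mu> :: real and \<psi> :: "nat \<Rightarrow> nat \<Rightarrow> real"
    and m :: nat and w0 :: 'm
    and J :: "nat \<times> nat \<Rightarrow> nat set"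
begin

definition batch_grad :: "nat set \<Rightarrow> 'm \<Rightarrow> 'e" where
  "batch_grad I x = (\<Sum>i\<in>I. grad X (fi i) x) /\<^sub>R real (card I)"

text \<open>
  The next direction at \<open>y = R x \<eta>\<close>, where \<open>x\<close> is the previous iterate, \<open>v\<close> the previous direction, \<open>x0\<close>
  the first iterate of the epoch, \<open>p\<close> the given parameter and \<open>I\<close> the index set.  The transport from \<open>x0\<close> to
  \<open>y\<close> is along the tangent vector at \<open>x0\<close> of norm less than \<open>\<rho>\<close> that \<open>R\<close> maps to \<open>y\<close>.
\<close>

definition hybrid_direction ::
  "real \<Rightarrow> 'm \<Rightarrow> 'm \<Rightarrow> 'e \<Rightarrow> 'e \<Rightarrow> 'm \<Rightarrow> nat set \<Rightarrow> 'e" where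
  "hybrid_direction p x0 x v \<eta> y I =
     (let D = metric X y (T x \<eta> (v - grad X f x)) (grad X f y);
          q = (if D \<noteq> 0 then min p (\<mu> * (tnorm X y (grad X f y))\<^sup>2 / \<bar>D\<bar>) else p);
          \<eta>0 = retr_inv X R \<rho> x0 y
      in (1 - q) *\<^sub>R (batch_grad I y - T x0 \<eta>0 (batch_grad I x0 - grad X f x0))
         + q *\<^sub>R (batch_grad I y - T x \<eta> (batch_grad I x - v)))"

text \<open>
  The pair of the iterate and the direction in step \<open>t\<close> of epoch \<open>s\<close> started at \<open>x0\<close>.  The recursion is
  not cut off at \<open>t = m\<close>; of the pair for \<open>t = m\<close> only the iterate belongs to the algorithm.
\<close>

primrec epoch_step :: "nat \<Rightarrow> 'm \<Rightarrow> nat \<Rightarrow> 'm \<times> 'e" where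
  "epoch_step s x0 0 = (x0, grad X f x0)"
| "epoch_step s x0 (Suc t) =
     (let (x, v) = epoch_step s x0 t;
          \<eta> = - (\<alpha> s t *\<^sub>R v);
          y = R x \<eta>
      in (y, hybrid_direction (\<psi> s (Suc t)) x0 x v \<eta> y (J (s, Suc t))))"

primrec epoch_output :: "nat \<Rightarrow> 'm" where
  "epoch_output 0 = w0"
| "epoch_output (Suc s) = fst (epoch_step (Suc s) (epoch_output s) m)"

definition iterate :: "nat \<Rightarrow> nat \<Rightarrow> 'm" where
  "iterate s t = fst (epoch_step s (epoch_output (s - 1)) t)"

definition direction :: "nat \<Rightarrow> nat \<Rightarrow> 'e" where
  "direction s t = snd (epoch_step s (epoch_output (s - 1)) t)"

end

text \<open>
  The joint law of the index \<open>(s, t)\<close> of the output and of the index sets in \<open>S\<close> epochs: all are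
  independent and uniformly distributed.
\<close>

definition run_pmf :: "nat \<Rightarrow> nat \<Rightarrow> nat \<Rightarrow> nat \<Rightarrow> ((nat \<times> nat) \<times> (nat \<times> nat \<Rightarrow> nat set)) pmf" where
  "run_pmf S m n b =
     pair_pmf (pmf_of_set ({1..S} \<times> {..<m}))
       (Pi_pmf ({1..S} \<times> {1..<m}) {} (\<lambda>_. pmf_of_set (minibatches n b)))"

text \<open>The possible families of index sets of a run with infinitely many epochs.\<close>

definition runs :: "nat \<Rightarrow> nat \<Rightarrow> nat \<Rightarrow> (nat \<times> nat \<Rightarrow> nat set) set" where
  "runs m n b = {J. \<forall>s\<ge>1. \<forall>t\<in>{1..<m}. J (s, t) \<in> minibatches n b}"

end

theory Submission
  imports Defs
begin

text \<open>
  Write \<open>g\<^sub>t\<close> for the gradient of \<open>f\<close> at the iterate in step \<open>t\<close> of an epoch, \<open>v\<^sub>t\<close> for the direction,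
  \<open>e\<^sub>t = v\<^sub>t - g\<^sub>t\<close> for its error and \<open>h\<close> for the step size.  The quadratic upper bound on \<open>f\<close> and
  \<open>2 \<langle>g\<^sub>t, v\<^sub>t\<rangle> = |g\<^sub>t|\<^sup>2 + |v\<^sub>t|\<^sup>2 - |e\<^sub>t|\<^sup>2\<close> show that one step lowers \<open>f\<close> by at least
  \<open>h/2 |g\<^sub>t|\<^sup>2 + h/2 (1 - L h) |v\<^sub>t|\<^sup>2 - h/2 |e\<^sub>t|\<^sup>2\<close> (\<open>descent\<close>).  If the expected squared errors of an
  epoch add up to at most \<open>1 - L h\<close> times the expected squared directions, then summing over all steps
  leaves the gradients only, and the total decrease of \<open>f\<close> is at most \<open>f w0 - f wstar\<close>.  This is the
  first term of the bound; the series of the squared \<open>\<psi>\<close> adds a nonnegative amount.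

  The errors obey a recursion.  With \<open>q\<close> the truncated parameter, the direction is the average over the
  index set of \<open>a\<^sub>i\<close>, centred at its mean over all \<open>i\<close>, plus \<open>g\<^sub>t + q T e\<^bsub>t-1\<^esub>\<close>, where \<open>a\<^sub>i\<close> is the convex
  combination, with weights \<open>1 - q\<close> and \<open>q\<close>, of the differences between the gradient of \<open>f\<^sub>i\<close> at the
  present point and its transports from the first iterate of the epoch and from the previous one
  (\<open>hybrid_direction_error\<close>).  Averaging over the index set kills the cross term, so the conditional
  expectation of \<open>|e\<^sub>t|\<^sup>2\<close> is at most the mean of \<open>|a\<^sub>i|\<^sup>2\<close> plus \<open>|e\<^bsub>t-1\<^esub>|\<^sup>2\<close>
  (\<open>minibatch_variance\<close>, \<open>hybrid_direction_variance\<close>), whatever \<open>q\<close> in the unit interval is.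

  The mean of \<open>|a\<^sub>i|\<^sup>2\<close> is controlled by distances (\<open>gradient_transport_error\<close>).  Transport and parallel
  translation are compared from the old point to the new one, but gradients are compared by a tangent
  vector at the new point; both vectors are bounded by \<open>C1\<close> times the distance, because the Riemannian
  distance is symmetric.  By the triangle inequality the distance is at most \<open>C2 h\<close> times the sum of the
  norms of the earlier directions of the epoch.  For this each step \<open>- h v\<^sub>t\<close> has to be short enough for
  the comparison of norm and distance.  It is: the segment from \<open>0\<close> to it is retracted into \<open>\<Omega>\<close>, so it
  cannot leave the ball on which the retraction is a diffeomorphism onto a set containing \<open>\<Omega>\<close>
  (\<open>ray_in_tball\<close>).  The Cauchy-Schwarz inequality turns all this into
  \<open>E |e\<^sub>t|\<^sup>2 \<le> \<kappa> t (E |v\<^sub>0|\<^sup>2 + ... + E |v\<^bsub>t-1\<^esub>|\<^sup>2) + E |e\<^bsub>t-1\<^esub>|\<^sup>2\<close>, hence the squared errors of an epoch add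
  up to at most \<open>\<kappa> m\<^sup>3 = \<nu> h\<^sup>2 / 2\<close> times the squared directions, and the restriction on the step size
  makes that factor at most \<open>1 - L h\<close> (\<open>step_size_condition\<close>).
\<close>

section \<open>Tangent spaces and gradients\<close>

lemma metric_bilinear: "riemannian_manifold X \<Longrightarrow> bilinear (metric X x)"
  and metric_sym: "riemannian_manifold X \<Longrightarrow> metric X x v w = metric X x w v"
  and metric_pos: "riemannian_manifold X \<Longrightarrow> v \<noteq> 0 \<Longrightarrow> metric X x v v > 0"
  by (simp_all add: riemannian_manifold_def)

lemma metric_nonneg:
  assumes "riemannian_manifold X"
  shows "metric X x v v \<ge> 0"
  using metric_pos[OF assms, of v x] bilinear_lzero[OF metric_bilinear[OF assms], of x 0]
  by (cases "v = 0") auto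

lemmas bilinear_simps =
  bilinear_ladd bilinear_radd bilinear_lsub bilinear_rsub bilinear_lmul bilinear_rmul
  bilinear_lneg bilinear_rneg bilinear_lzero bilinear_rzero

lemma tnorm_sq:
  assumes "riemannian_manifold X"
  shows "(tnorm X x v)\<^sup>2 = metric X x v v"
  using metric_nonneg[OF assms] by (simp add: tnorm_def)

lemma tnorm_nonneg: "riemannian_manifold X \<Longrightarrow> tnorm X x v \<ge> 0"
  using metric_nonneg by (simp add: tnorm_def)

lemma tnorm_scaleR:
  assumes "riemannian_manifold X"
  shows "tnorm X x (c *\<^sub>R v) = \<bar>c\<bar> * tnorm X x v"
  using metric_bilinear[OF assms]
  by (simp add: tnorm_def bilinear_simps real_sqrt_mult flip: mult.assoc)

lemma tnorm_minus: "riemannian_manifold X \<Longrightarrow> tnorm X x (- v) = tnorm X x v"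
  using tnorm_scaleR[of X x "-1" v] by simp

lemma tnorm_add_sq_le:
  assumes "riemannian_manifold X"
  shows "(tnorm X x (v + w))\<^sup>2 \<le> 2 * (tnorm X x v)\<^sup>2 + 2 * (tnorm X x w)\<^sup>2"
  using metric_bilinear[OF assms, of x] metric_sym[OF assms, of x w v]
    metric_nonneg[OF assms, of x "v - w"]
  by (simp add: tnorm_sq[OF assms] bilinear_simps)

lemma tnorm_convex_sq:
  assumes "riemannian_manifold X" "0 \<le> q" "q \<le> 1"
  shows "(tnorm X x ((1 - q) *\<^sub>R v + q *\<^sub>R w))\<^sup>2
           \<le> (1 - q) * (tnorm X x v)\<^sup>2 + q * (tnorm X x w)\<^sup>2"
proof -
  have "0 \<le> q * (1 - q) * metric X x (v - w) (v - w)"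
    using assms metric_nonneg[OF assms(1)] by simp
  then show ?thesis
    using metric_bilinear[OF assms(1), of x] metric_sym[OF assms(1), of x w v]
    by (simp add: tnorm_sq[OF assms(1)] bilinear_simps algebra_simps)
qed

text \<open>
  The inner product of \<open>'e\<close> turns the metric into a linear endomorphism \<open>A\<close>, which is injective since
  the metric is definite, hence bijective by finite dimension.  So the metric, although it is not the
  inner product of the type, represents every linear form, and \<open>grad\<close> is a genuine gradient.
\<close>

lemma metric_representer:
  assumes X: "riemannian_manifold X" and l: "linear l"
  shows "\<exists>!v. \<forall>w. metric X x v w = l w"
proof -
  note bil = metric_bilinear[OF X, of x]
  define A where "A v = (\<Sum>b\<in>Basis. metric X x v b *\<^sub>R b)" for v
  have A: "linear A"
    unfolding A_def using bil
    by (intro linearI) (simp_all add: bilinear_simps scaleR_add_left sum.distrib scaleR_sum_right)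
  have inner_A: "A v \<bullet> w = metric X x v w" for v w
  proof -
    have "A v \<bullet> w = (\<Sum>b\<in>Basis. (w \<bullet> b) * metric X x v b)"
      by (simp add: A_def inner_sum_left inner_commute[of w] mult.commute)
    also have "\<dots> = (\<Sum>b\<in>Basis. metric X x v ((w \<bullet> b) *\<^sub>R b))"
      using bil by (simp add: bilinear_simps)
    also have "\<dots> = metric X x v (\<Sum>b\<in>Basis. (w \<bullet> b) *\<^sub>R b)"
      using bil by (simp add: bilinear_def linear_sum)
    finally show ?thesis by (simp add: euclidean_representation)
  qed
  have "inj A"
  proof (rule iffD2[OF linear_injective_0[OF A]], intro allI impI)
    fix v assume "A v = 0"
    then have "metric X x v v = 0" using inner_A[of v v] by simp
    then show "v = 0" using metric_pos[OF X, of v x] by fastforce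
  qed
  have rep: "(\<forall>w. metric X x v w = l w) \<longleftrightarrow> A v = (\<Sum>b\<in>Basis. l b *\<^sub>R b)" for v
  proof -
    have "l w = (\<Sum>b\<in>Basis. l b *\<^sub>R b) \<bullet> w" for w
    proof -
      have "l w = l (\<Sum>b\<in>Basis. (w \<bullet> b) *\<^sub>R b)" by (simp add: euclidean_representation)
      also have "\<dots> = (\<Sum>b\<in>Basis. (w \<bullet> b) * l b)"
        using l by (simp add: linear_sum linear_cmul)
      finally show ?thesis by (simp add: inner_sum_left inner_commute[of w] mult.commute)
    qed
    then show ?thesis unfolding inner_A[symmetric] by (metis vector_eq_rdot)
  qed
  obtain v where v: "A v = (\<Sum>b\<in>Basis. l b *\<^sub>R b)"
    using surjD[OF linear_injective_imp_surjective[OF A \<open>inj A\<close>]] by metis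
  have v_unique: "u = v" if "A u = (\<Sum>b\<in>Basis. l b *\<^sub>R b)" for u
    using injD[OF \<open>inj A\<close>, of u v] that v by simp
  show ?thesis
    unfolding rep by (rule ex1I[of _ v]) (fact v, fact v_unique)
qed

lemma C1_fun_differentiable:
  assumes X: "riemannian_manifold X" and h: "C1_fun X h"
  shows "(h \<circ> cinv (chart_at X x)) differentiable (at (cmap (chart_at X x) x))"
proof -
  have "chart_at X x \<in> atlas X" "x \<in> cdom (chart_at X x)"
    using X by (simp_all add: riemannian_manifold_def)
  then show ?thesis using h by (auto simp: C1_fun_def)
qed

lemma metric_grad:
  assumes X: "riemannian_manifold X" and h: "C1_fun X h"
  shows "metric X x (grad X h x) w =
           frechet_derivative (h \<circ> cinv (chart_at X x)) (at (cmap (chart_at X x) x)) w"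
proof -
  from metric_representer[OF X linear_frechet_derivative[OF C1_fun_differentiable[OF X h]]]
  have "\<forall>w. metric X x (grad X h x) w =
      frechet_derivative (h \<circ> cinv (chart_at X x)) (at (cmap (chart_at X x) x)) w"
    unfolding grad_def by (rule theI')
  then show ?thesis by (rule spec)
qed

lemma grad_average:
  assumes X: "riemannian_manifold X"
    and C1: "\<And>i. i \<in> {1..n} \<Longrightarrow> C1_fun X (fi i)"
    and f: "f = (\<lambda>x. (\<Sum>i=1..n. fi i x) / real n)" and C1f: "C1_fun X f"
  shows "grad X f x = (\<Sum>i=1..n. grad X (fi i) x) /\<^sub>R real n"
proof -
  let ?c = "chart_at X x"
  let ?u = "cmap ?c x"
  have D: "((fi i \<circ> cinv ?c) has_derivative frechet_derivative (fi i \<circ> cinv ?c) (at ?u)) (at ?u)"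
    if "i \<in> {1..n}" for i
    using C1_fun_differentiable[OF X C1[OF that]] by (rule frechet_derivative_works[THEN iffD1])
  have "((\<lambda>u. \<Sum>i=1..n. (fi i \<circ> cinv ?c) u) has_derivative
           (\<lambda>w. \<Sum>i=1..n. frechet_derivative (fi i \<circ> cinv ?c) (at ?u) w)) (at ?u)"
    by (rule has_derivative_sum) (rule D)
  then have "((\<lambda>u. (\<Sum>i=1..n. (fi i \<circ> cinv ?c) u) / real n) has_derivative
           (\<lambda>w. (\<Sum>i=1..n. frechet_derivative (fi i \<circ> cinv ?c) (at ?u) w) / real n)) (at ?u)"
    unfolding divide_inverse by (rule has_derivative_mult_left)
  moreover have "(\<lambda>u. (\<Sum>i=1..n. (fi i \<circ> cinv ?c) u) / real n) = f \<circ> cinv ?c"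
    by (simp add: f fun_eq_iff)
  ultimately have "((f \<circ> cinv ?c) has_derivative
       (\<lambda>w. (\<Sum>i=1..n. frechet_derivative (fi i \<circ> cinv ?c) (at ?u) w) / real n)) (at ?u)"
    by (simp only:)
  from frechet_derivative_at[OF this, symmetric] have Df: "frechet_derivative (f \<circ> cinv ?c) (at ?u) =
       (\<lambda>w. (\<Sum>i=1..n. frechet_derivative (fi i \<circ> cinv ?c) (at ?u) w) / real n)" .
  have "metric X x ((\<Sum>i=1..n. grad X (fi i) x) /\<^sub>R real n) w = metric X x (grad X f x) w" for w
  proof -
    have bil: "bilinear (metric X x)" by (rule metric_bilinear[OF X])
    then have lin: "linear (\<lambda>v. metric X x v w)" by (simp add: bilinear_def)
    have "metric X x ((\<Sum>i=1..n. grad X (fi i) x) /\<^sub>R real n) w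
        = metric X x (\<Sum>i=1..n. grad X (fi i) x) w / real n"
      using bil by (simp add: bilinear_lmul divide_inverse mult.commute)
    also have "\<dots> = (\<Sum>i=1..n. metric X x (grad X (fi i) x) w) / real n"
      by (simp only: linear_sum[OF lin])
    also have "\<dots> = (\<Sum>i=1..n. frechet_derivative (fi i \<circ> cinv ?c) (at ?u) w) / real n"
      by (intro arg_cong2[of _ _ _ _ "(/)"] sum.cong refl metric_grad[OF X C1])
    also have "\<dots> = metric X x (grad X f x) w" by (simp add: metric_grad[OF X C1f] Df)
    finally show ?thesis .
  qed
  then have "metric X x (grad X f x - (\<Sum>i=1..n. grad X (fi i) x) /\<^sub>R real n) w = 0" for w
    using metric_bilinear[OF X, of x] by (simp add: bilinear_simps)
  then have "grad X f x - (\<Sum>i=1..n. grad X (fi i) x) /\<^sub>R real n = 0"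
    using metric_pos[OF X] less_irrefl by metis
  then show ?thesis by simp
qed


section \<open>The Riemannian distance\<close>

lemma pw_C1_path_append:
  "pw_C1_path X x y l \<Longrightarrow> pw_C1_path X y z k \<Longrightarrow> pw_C1_path X x z (l + k)"
  by (induction rule: pw_C1_path.induct) (auto simp: add.assoc intro: pw_C1_path.intros)

text \<open>
  Curves that nearly realise the two distances are concatenated; infinite distances are trivial.
\<close>

lemma rdist_triangle: "rdist X x z \<le> rdist X x y + rdist X y z"
proof (rule ennreal_le_epsilon)
  fix e :: real assume fin: "rdist X x y + rdist X y z < top" and e: "0 < e"
  have near: "\<exists>l. pw_C1_path X p q l \<and> ennreal l < rdist X p q + ennreal (e / 2)"
    if "rdist X p q < top" for p q
  proof -
    define r where "r = enn2real (rdist X p q)"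
    have "rdist X p q = ennreal r" "0 \<le> r" using that by (simp_all add: r_def)
    then have "rdist X p q < rdist X p q + ennreal (e / 2)"
      using e by (simp add: ennreal_less_iff flip: ennreal_plus)
    then show ?thesis unfolding rdist_def[of X p q] by (subst (asm) INF_less_iff) auto
  qed
  from fin obtain l k where l: "pw_C1_path X x y l" "ennreal l < rdist X x y + ennreal (e / 2)"
    and k: "pw_C1_path X y z k" "ennreal k < rdist X y z + ennreal (e / 2)"
    using near[of x y] near[of y z] by auto
  have "rdist X x z \<le> ennreal (l + k)"
    unfolding rdist_def by (rule INF_lower) (simp add: pw_C1_path_append[OF l(1) k(1)])
  also have "\<dots> \<le> ennreal (max 0 l + max 0 k)" by (intro ennreal_leI) auto
  also have "\<dots> = ennreal l + ennreal k" by (simp add: max_def ennreal_neg)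
  also have "\<dots> \<le> (rdist X x y + ennreal (e / 2)) + (rdist X y z + ennreal (e / 2))"
    using l(2) k(2) by (intro add_mono) auto
  also have "\<dots> = rdist X x y + rdist X y z + (ennreal (e / 2) + ennreal (e / 2))"
    by (simp add: ac_simps)
  also have "ennreal (e / 2) + ennreal (e / 2) = ennreal e"
    using e by (simp flip: ennreal_plus)
  finally show "rdist X x z \<le> rdist X x y + rdist X y z + ennreal e" .
qed

lemma image_reflect_unit: "(\<lambda>t::real. 1 - t) ` {0..1} = {0..1}"
  by (auto simp: image_iff intro!: bexI[of _ "1 - x" for x])

lemma integral_reflect_unit:
  fixes F :: "real \<Rightarrow> real"
  shows "integral {0..1} (\<lambda>t. F (1 - t)) = integral {0..1} F"
proof -
  \<comment> \<open>The reflection is an involution, so it preserves integrability in both directions; a function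
    that is not integrable has integral \<open>0\<close>.\<close>
  have *: "((\<lambda>t. G (1 - t)) has_integral i) {0..1}" if "(G has_integral i) {0..1}"
    for G :: "real \<Rightarrow> real" and i
  proof -
    have img: "(\<lambda>x::real. 1 - x) ` {0..1} = {0..1}" by (rule image_reflect_unit)
    show ?thesis
      using has_integral_affinity[of G i 0 1 "-1" 1] that by (simp add: img)
  qed
  show ?thesis
  proof (cases "F integrable_on {0..1}")
    case True
    then show ?thesis using *[OF integrable_integral[OF True]] by (simp add: integral_unique)
  next
    case False
    have "\<not> (\<lambda>t. F (1 - t)) integrable_on {0..1}"
    proof
      assume "(\<lambda>t. F (1 - t)) integrable_on {0..1}"
      from *[OF integrable_integral[OF this]] False show False by (auto simp: integrable_on_def)
    qed
    then show ?thesis using False by (simp add: not_integrable_integral)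
  qed
qed

lemma vector_derivative_reflect_unit:
  fixes g :: "real \<Rightarrow> 'a::euclidean_space"
  assumes t: "t \<in> {0..1}" and g: "g differentiable (at (1 - t) within {0..1})"
  shows "((\<lambda>s. g (1 - s)) has_vector_derivative - vector_derivative g (at (1 - t) within {0..1}))
           (at t within {0..1})"
proof -
  have "((\<lambda>s::real. 1 - s) has_vector_derivative -1) (at t within {0..1})"
    by (auto intro!: derivative_eq_intros)
  moreover have "(g has_vector_derivative vector_derivative g (at (1 - t) within {0..1}))
      (at (1 - t) within (\<lambda>s. 1 - s) ` {0..1})"
    using g by (simp add: image_reflect_unit vector_derivative_works)
  ultimately show ?thesis using vector_diff_chain_within by (fastforce simp: o_def)
qed

text \<open>
  Velocities along the reversed curve change sign only, and the norm does not see the sign.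
\<close>

lemma C1_curve_reverse:
  assumes X: "riemannian_manifold X" and \<gamma>: "C1_curve X \<gamma>"
  shows "C1_curve X (\<lambda>t. \<gamma> (1 - t))" and "curve_length X (\<lambda>t. \<gamma> (1 - t)) = curve_length X \<gamma>"
proof -
  have D: "((\<lambda>s. cmap c (\<gamma> (1 - s))) has_vector_derivative
      - vector_derivative (cmap c \<circ> \<gamma>) (at (1 - t) within {0..1})) (at t within {0..1})"
    if "c \<in> atlas X" "t \<in> {0..1}" "\<gamma> (1 - t) \<in> cdom c" for c t
    using vector_derivative_reflect_unit[of t "cmap c \<circ> \<gamma>"] \<gamma> that by (auto simp: C1_curve_def)
  have vd: "vector_derivative (\<lambda>s. cmap c (\<gamma> (1 - s))) (at t within {0..1})
      = - vector_derivative (cmap c \<circ> \<gamma>) (at (1 - t) within {0..1})"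
    if "c \<in> atlas X" "t \<in> {0..1}" "\<gamma> (1 - t) \<in> cdom c" for c t
    using D[OF that] that by (intro vector_derivative_within_closed_interval) auto
  show "C1_curve X (\<lambda>t. \<gamma> (1 - t))"
    unfolding C1_curve_def
  proof (intro conjI ballI impI)
    have "continuous_on {0..1} \<gamma>" using \<gamma> by (simp add: C1_curve_def)
    moreover have "continuous_on {0..1} (\<lambda>t::real. 1 - t)" by (intro continuous_intros)
    ultimately show "continuous_on {0..1} (\<lambda>t. \<gamma> (1 - t))"
      by (rule continuous_on_compose2) auto
  next
    fix c t assume "c \<in> atlas X" "t \<in> {0..1::real}" "\<gamma> (1 - t) \<in> cdom c"
    from D[OF this] show "(cmap c \<circ> (\<lambda>t. \<gamma> (1 - t))) differentiable at t within {0..1}"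
      by (auto simp: o_def has_vector_derivative_def differentiable_def)
  next
    fix c assume c: "c \<in> atlas X"
    let ?D = "\<lambda>t. vector_derivative (cmap c \<circ> \<gamma>) (at t within {0..1})"
    have "continuous_on {t \<in> {0..1}. \<gamma> t \<in> cdom c} ?D"
      using \<gamma> c by (simp add: C1_curve_def)
    moreover have "continuous_on {t \<in> {0..1}. \<gamma> (1 - t) \<in> cdom c} (\<lambda>t::real. 1 - t)"
      by (intro continuous_intros)
    ultimately have "continuous_on {t \<in> {0..1}. \<gamma> (1 - t) \<in> cdom c} (\<lambda>t. ?D (1 - t))"
      by (rule continuous_on_compose2) auto
    then have "continuous_on {t \<in> {0..1}. \<gamma> (1 - t) \<in> cdom c} (\<lambda>t. - ?D (1 - t))"
      by (rule continuous_on_minus)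
    then show "continuous_on {t \<in> {0..1}. \<gamma> (1 - t) \<in> cdom c}
        (\<lambda>t. vector_derivative (cmap c \<circ> (\<lambda>t. \<gamma> (1 - t))) (at t within {0..1}))"
      by (rule continuous_on_eq) (use vd[OF c] in \<open>auto simp: o_def\<close>)
  qed
  have vel: "velocity X (\<lambda>t. \<gamma> (1 - t)) t = - velocity X \<gamma> (1 - t)" if "t \<in> {0..1}" for t
    unfolding velocity_def using vd[of "chart_at X (\<gamma> (1 - t))" t] that X
    by (simp add: o_def riemannian_manifold_def)
  have "curve_length X (\<lambda>t. \<gamma> (1 - t))
      = integral {0..1} (\<lambda>t. tnorm X (\<gamma> (1 - t)) (velocity X \<gamma> (1 - t)))"
    unfolding curve_length_def
    by (intro Henstock_Kurzweil_Integration.integral_cong) (simp add: vel tnorm_minus[OF X])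
  then show "curve_length X (\<lambda>t. \<gamma> (1 - t)) = curve_length X \<gamma>"
    using integral_reflect_unit[of "\<lambda>t. tnorm X (\<gamma> t) (velocity X \<gamma> t)"]
    by (simp add: curve_length_def)
qed

lemma pw_C1_path_reverse:
  assumes X: "riemannian_manifold X" and "pw_C1_path X x y l"
  shows "pw_C1_path X y x l"
  using assms(2)
proof induction
  case (2 \<gamma> z l)
  have "pw_C1_path X (\<gamma> 1) (\<gamma> 0) (curve_length X \<gamma> + 0)"
    using pw_C1_path.intros(2)[OF C1_curve_reverse(1)[OF X 2(1)] pw_C1_path.intros(1)]
    by (simp add: C1_curve_reverse(2)[OF X 2(1)])
  from pw_C1_path_append[OF 2(3) this] show ?case by (simp add: add.commute)
qed (rule pw_C1_path.intros)

lemma rdist_commute: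
  assumes X: "riemannian_manifold X"
  shows "rdist X x y = rdist X y x"
proof -
  have "{l. pw_C1_path X x y l} = {l. pw_C1_path X y x l}"
    using pw_C1_path_reverse[OF X, of x y] pw_C1_path_reverse[OF X, of y x] by blast
  then show ?thesis by (simp add: rdist_def)
qed


section \<open>Retractions along rays\<close>

lemma chart_at_props:
  assumes X: "riemannian_manifold X"
  shows "chart_at X x \<in> atlas X" "x \<in> cdom (chart_at X x)"
    and "cinv (chart_at X x) (cmap (chart_at X x) x) = x"
    and "tvec X (chart_at X x) (cmap (chart_at X x) x) a = a"
proof -
  let ?d = "chart_at X x"
  show d: "?d \<in> atlas X" "x \<in> cdom ?d" using X by (simp_all add: riemannian_manifold_def)
  then have hom: "homeomorphism (cdom ?d) (crange ?d) (cmap ?d) (cinv ?d)"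
    and op: "open (crange ?d)"
    using X by (simp_all add: riemannian_manifold_def)
  show inv: "cinv ?d (cmap ?d x) = x" using homeomorphism_apply1[OF hom d(2)] .
  have u: "cmap ?d x \<in> crange ?d" using d(2) by simp
  have "((\<lambda>u. u) has_derivative (\<lambda>h. h)) (at (cmap ?d x))" by (rule has_derivative_ident)
  then have "((cmap ?d \<circ> cinv ?d) has_derivative (\<lambda>h. h)) (at (cmap ?d x))"
    by (rule has_derivative_transform_within_open[OF _ op u])
      (simp add: homeomorphism_apply2[OF hom])
  from frechet_derivative_at[OF this, symmetric]
  show "tvec X ?d (cmap ?d x) a = a" by (simp add: tvec_def inv)
qed

text \<open>
  The smoothness of a retraction is stated for coordinates on the tangent bundle.  In the preferred chart
  at \<open>x\<close>, tangent vectors at \<open>x\<close> are their own coordinates, so fixing the base point is a continuous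
  insertion.
\<close>

lemma continuous_on_retraction:
  assumes X: "riemannian_manifold X" and R: "riemannian_retraction X R" and c: "c \<in> atlas X"
  shows "open {a. R x a \<in> cdom c}"
    and "continuous_on {a. R x a \<in> cdom c} (\<lambda>a. cmap c (R x a))"
proof -
  let ?d = "chart_at X x"
  let ?u = "cmap ?d x"
  note d = chart_at_props[OF X, of x]
  have dom: "{a. R x a \<in> cdom c} = Pair ?u -` retr_dom X R ?d c"
    using d by (auto simp: retr_dom_def)
  have op: "open (retr_dom X R ?d c)"
    and sm: "smooth_on (\<lambda>(u, a). cmap c (R (cinv ?d u) (tvec X ?d u a))) (retr_dom X R ?d c)"
    using R d(1) c by (simp_all add: riemannian_retraction_def)
  show "open {a. R x a \<in> cdom c}"
    unfolding dom by (intro open_vimage[OF op] continuous_intros)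
  have "Ck_on 0 (\<lambda>(u, a). cmap c (R (cinv ?d u) (tvec X ?d u a))) (retr_dom X R ?d c)"
    using sm unfolding smooth_on_def by blast
  then have "continuous_on (retr_dom X R ?d c) (\<lambda>(u, a). cmap c (R (cinv ?d u) (tvec X ?d u a)))"
    by simp
  moreover have "continuous_on {a. R x a \<in> cdom c} (Pair ?u)" by (intro continuous_intros)
  ultimately have "continuous_on {a. R x a \<in> cdom c}
      (\<lambda>a. (\<lambda>(u, a). cmap c (R (cinv ?d u) (tvec X ?d u a))) (Pair ?u a))"
    by (rule continuous_on_compose2) (auto simp: dom)
  then show "continuous_on {a. R x a \<in> cdom c} (\<lambda>a. cmap c (R x a))" by (simp add: d)
qed

text \<open>
  The retraction need not be injective outside the ball, so the endpoint lying in the image of the ball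
  does not suffice; the whole ray is used.  Before it reaches the boundary of the ball, the continuous
  local inverse recovers \<open>\<tau> v\<close> from its retraction.  By continuity this holds at the boundary point
  too, whereas the local inverse only takes values in the open ball.
\<close>

lemma ray_in_tball:
  assumes X: "riemannian_manifold X" and R: "riemannian_retraction X R"
    and diffeo: "diffeo_on_tball X R \<rho> x" and \<rho>: "\<rho> > 0"
    and ray: "\<And>\<tau>. \<tau> \<in> {0..1} \<Longrightarrow> R x (\<tau> *\<^sub>R v) \<in> R x ` tball X x \<rho>"
  shows "v \<in> tball X x \<rho>"
proof (rule ccontr)
  assume "v \<notin> tball X x \<rho>"
  then have v: "tnorm X x v \<ge> \<rho>" by (simp add: tball_def)
  \<comment> \<open>the parameter at which the ray reaches the boundary of the ball\<close>
  define \<sigma> where "\<sigma> = \<rho> / tnorm X x v"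
  have \<sigma>: "0 < \<sigma>" "\<sigma> \<le> 1" using v \<rho> by (simp_all add: \<sigma>_def)
  have norm_\<sigma>: "tnorm X x (\<sigma> *\<^sub>R v) = \<rho>" using v \<rho> \<sigma> by (simp add: tnorm_scaleR[OF X] \<sigma>_def)
  have before: "\<tau> *\<^sub>R v \<in> tball X x \<rho>" if "0 < \<tau>" "\<tau> < \<sigma>" for \<tau>
    using that v \<rho> by (simp add: tball_def tnorm_scaleR[OF X] \<sigma>_def field_simps)
  define y where "y = R x (\<sigma> *\<^sub>R v)"
  let ?c = "chart_at X y"
  note c = chart_at_props[OF X, of y]
  define A where "A = {a. R x a \<in> cdom ?c}"
  define Q where "Q = A \<inter> {a. R x a \<in> R x ` tball X x \<rho>}"
  let ?W = "cmap ?c ` (cdom ?c \<inter> R x ` tball X x \<rho>)"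
  have "smooth_on (retr_inv X R \<rho> x \<circ> cinv ?c) ?W"
    using diffeo c(1) by (simp add: diffeo_on_tball_def)
  then have "Ck_on 0 (retr_inv X R \<rho> x \<circ> cinv ?c) ?W" unfolding smooth_on_def by blast
  then have "continuous_on ?W (retr_inv X R \<rho> x \<circ> cinv ?c)" by simp
  moreover have "continuous_on Q (\<lambda>a. cmap ?c (R x a))"
    using continuous_on_retraction(2)[OF X R c(1)]
    by (rule continuous_on_subset) (auto simp: Q_def A_def)
  ultimately have "continuous_on Q (\<lambda>a. (retr_inv X R \<rho> x \<circ> cinv ?c) (cmap ?c (R x a)))"
    by (rule continuous_on_compose2) (auto simp: Q_def A_def)
  moreover have "(retr_inv X R \<rho> x \<circ> cinv ?c) (cmap ?c (R x a)) = retr_inv X R \<rho> x (R x a)"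
    if "a \<in> Q" for a
  proof -
    have "homeomorphism (cdom ?c) (crange ?c) (cmap ?c) (cinv ?c)"
      using X c(1) by (simp add: riemannian_manifold_def)
    from homeomorphism_apply1[OF this] show ?thesis using that by (simp add: Q_def A_def)
  qed
  ultimately have cont: "continuous_on Q (\<lambda>a. retr_inv X R \<rho> x (R x a))"
    by (rule continuous_on_eq)
  have lim: "((\<lambda>\<tau>. \<tau> *\<^sub>R v) \<longlongrightarrow> \<sigma> *\<^sub>R v) (at_left \<sigma>)" by (intro tendsto_intros)
  have \<sigma>Q: "\<sigma> *\<^sub>R v \<in> Q" using ray[of \<sigma>] \<sigma> c(2) by (simp add: Q_def A_def y_def)
  have ev: "\<forall>\<^sub>F \<tau> in at_left \<sigma>. 0 < \<tau> \<and> \<tau> < \<sigma>"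
    using eventually_at_left_real[OF \<sigma>(1)] by eventually_elim auto
  have "open A" unfolding A_def by (rule continuous_on_retraction(1)[OF X R c(1)])
  moreover have "\<sigma> *\<^sub>R v \<in> A" using \<sigma>Q by (simp add: Q_def)
  ultimately have "\<forall>\<^sub>F \<tau> in at_left \<sigma>. \<tau> *\<^sub>R v \<in> A" by (rule topological_tendstoD[OF lim])
  with ev have "\<forall>\<^sub>F \<tau> in at_left \<sigma>. \<tau> *\<^sub>R v \<in> Q"
    by eventually_elim (use ray \<sigma> in \<open>simp add: Q_def\<close>)
  from continuous_on_tendsto_compose[OF cont lim \<sigma>Q this]
  have "((\<lambda>\<tau>. retr_inv X R \<rho> x (R x (\<tau> *\<^sub>R v))) \<longlongrightarrow> retr_inv X R \<rho> x y) (at_left \<sigma>)"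
    by (simp add: y_def)
  moreover have "\<forall>\<^sub>F \<tau> in at_left \<sigma>. retr_inv X R \<rho> x (R x (\<tau> *\<^sub>R v)) = \<tau> *\<^sub>R v"
    using ev
  proof eventually_elim
    case (elim \<tau>)
    have "inj_on (R x) (tball X x \<rho>)" using diffeo by (simp add: diffeo_on_tball_def)
    from inv_into_f_f[OF this before] elim show ?case by (simp add: retr_inv_def)
  qed
  ultimately have "((\<lambda>\<tau>. \<tau> *\<^sub>R v) \<longlongrightarrow> retr_inv X R \<rho> x y) (at_left \<sigma>)"
    by (rule Lim_transform_eventually)
  then have "\<sigma> *\<^sub>R v = retr_inv X R \<rho> x y"
    using tendsto_unique[OF _ lim] by simp
  moreover have "retr_inv X R \<rho> x y \<in> tball X x \<rho>"
    unfolding retr_inv_def y_def using ray[of \<sigma>] \<sigma> by (intro inv_into_into) simp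
  ultimately show False using norm_\<sigma> by (simp add: tball_def)
qed


section \<open>Sampling without replacement\<close>

lemma finite_minibatches: "finite (minibatches n b)"
  by (rule finite_subset[of _ "Pow {1..n}"]) (auto simp: minibatches_def)

lemma atLeastAtMost_in_minibatches: "b \<le> n \<Longrightarrow> {1..b} \<in> minibatches n b"
  by (auto simp: minibatches_def)

text \<open>
  Every index lies in the same fraction \<open>b / n\<close> of the index sets, which is the absorption identity of
  binomial coefficients.  This marginal is all that is used of the sampling scheme.
\<close>

lemma card_minibatches_containing:
  assumes i: "i \<in> {1..n}" and b: "b \<ge> 1"
  shows "n * card {I \<in> minibatches n b. i \<in> I} = b * card (minibatches n b)"
proof -
  have "{I \<in> minibatches n b. i \<in> I} = insert i ` {K. K \<subseteq> {1..n} - {i} \<and> card K = b - 1}"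
  proof (intro equalityI subsetI)
    fix I assume "I \<in> {I \<in> minibatches n b. i \<in> I}"
    then have I: "I \<subseteq> {1..n}" "card I = b" "i \<in> I" by (auto simp: minibatches_def)
    moreover from I have "finite I" by (auto intro: finite_subset)
    ultimately have "I = insert i (I - {i})" "I - {i} \<subseteq> {1..n} - {i} \<and> card (I - {i}) = b - 1"
      by (auto simp: card_Diff_singleton)
    then show "I \<in> insert i ` {K. K \<subseteq> {1..n} - {i} \<and> card K = b - 1}" by blast
  next
    fix I assume "I \<in> insert i ` {K. K \<subseteq> {1..n} - {i} \<and> card K = b - 1}"
    then obtain K where K: "K \<subseteq> {1..n} - {i}" "card K = b - 1" "I = insert i K" by auto
    moreover from K(1) have "finite K" "i \<notin> K" by (auto intro: finite_subset)
    ultimately show "I \<in> {I \<in> minibatches n b. i \<in> I}"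
      using i b by (auto simp: minibatches_def)
  qed
  moreover have "inj_on (insert i) {K. K \<subseteq> {1..n} - {i} \<and> card K = b - 1}"
    by (rule inj_onI) (metis (mono_tags, lifting) Diff_insert_absorb mem_Collect_eq subset_Diff_insert)
  ultimately have "card {I \<in> minibatches n b. i \<in> I} = (n - 1) choose (b - 1)"
    using i by (simp add: card_image n_subsets)
  moreover have "card (minibatches n b) = n choose b"
    using n_subsets[of "{1..n}" b] by (simp add: minibatches_def)
  ultimately show ?thesis
    using i b binomial_absorption[of "b - 1" "n"] by simp
qed

text \<open>
  Double counting.  The values are vectors because both the means of vectors and the means of their
  squared norms are needed.
\<close>

lemma minibatch_average:
  fixes a :: "nat \<Rightarrow> 'a::real_vector"
  assumes b: "1 \<le> b" "b \<le> n"
  shows "(\<Sum>I\<in>minibatches n b. (\<Sum>i\<in>I. a i) /\<^sub>R real b) /\<^sub>R real (card (minibatches n b))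
           = (\<Sum>i=1..n. a i) /\<^sub>R real n"
proof -
  let ?N = "real (card (minibatches n b))"
  have "minibatches n b \<noteq> {}" using atLeastAtMost_in_minibatches[OF b(2)] by auto
  then have N: "?N > 0" using finite_minibatches by (simp add: card_gt_0_iff)
  have "(\<Sum>I\<in>minibatches n b. \<Sum>i\<in>I. a i)
      = (\<Sum>I\<in>minibatches n b. \<Sum>i\<in>{i \<in> {1..n}. i \<in> I}. a i)"
    by (intro sum.cong refl) (auto simp: minibatches_def)
  also have "\<dots> = (\<Sum>i=1..n. \<Sum>I\<in>{I \<in> minibatches n b. i \<in> I}. a i)"
    by (rule sum.swap_restrict) (simp_all add: finite_minibatches)
  also have "\<dots> = (\<Sum>i=1..n. (real b * ?N / real n) *\<^sub>R a i)"
  proof (rule sum.cong[OF refl])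
    fix i assume i: "i \<in> {1..n}"
    have "real n * real (card {I \<in> minibatches n b. i \<in> I}) = real b * ?N"
      using card_minibatches_containing[OF i b(1)] by (metis of_nat_mult)
    then have "real (card {I \<in> minibatches n b. i \<in> I}) = real b * ?N / real n"
      using b by (simp add: field_simps)
    then show "(\<Sum>I\<in>{I \<in> minibatches n b. i \<in> I}. a i) = (real b * ?N / real n) *\<^sub>R a i"
      by (simp add: sum_constant_scaleR)
  qed
  finally have "(\<Sum>I\<in>minibatches n b. \<Sum>i\<in>I. a i) = (real b * ?N / real n) *\<^sub>R (\<Sum>i=1..n. a i)"
    by (simp only: scaleR_sum_right)
  then have "(\<Sum>I\<in>minibatches n b. \<Sum>i\<in>I. a i) /\<^sub>R (?N * real b) = (\<Sum>i=1..n. a i) /\<^sub>R real n"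
    using N b by (simp add: field_simps)
  then show ?thesis by (simp add: mult.commute flip: scaleR_sum_right)
qed

text \<open>
  The squared distances to the mean have a nonnegative sum.
\<close>

lemma tnorm_mean_sq_le:
  assumes X: "riemannian_manifold X" and I: "card I = k" "k \<ge> 1"
  shows "(tnorm X x ((\<Sum>i\<in>I. a i) /\<^sub>R real k))\<^sup>2 \<le> (\<Sum>i\<in>I. (tnorm X x (a i))\<^sup>2) / real k"
proof -
  let ?g = "metric X x"
  let ?B = "(\<Sum>i\<in>I. a i) /\<^sub>R real k"
  note bil = metric_bilinear[OF X, of x]
  have lin: "linear (\<lambda>v. ?g v ?B)" using bil by (simp add: bilinear_def)
  have B: "(\<Sum>i\<in>I. a i) = real k *\<^sub>R ?B" using I(2) by simp
  have "(\<Sum>i\<in>I. ?g (a i) ?B) = ?g (\<Sum>i\<in>I. a i) ?B" by (rule linear_sum[OF lin, symmetric])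
  also have "\<dots> = ?g (real k *\<^sub>R ?B) ?B" using B by (rule arg_cong)
  also have "\<dots> = real k * ?g ?B ?B" by (simp only: bilinear_lmul[OF bil] real_scaleR_def)
  finally have cross: "(\<Sum>i\<in>I. ?g (a i) ?B) = real k * ?g ?B ?B" .
  have expand: "?g (v - ?B) (v - ?B) = ?g v v - 2 * ?g v ?B + ?g ?B ?B" for v
    using metric_sym[OF X, of x ?B v]
    by (simp only: bilinear_lsub[OF bil] bilinear_rsub[OF bil])
  have "0 \<le> (\<Sum>i\<in>I. ?g (a i - ?B) (a i - ?B))" by (intro sum_nonneg metric_nonneg[OF X])
  also have "\<dots> = (\<Sum>i\<in>I. ?g (a i) (a i)) - 2 * (\<Sum>i\<in>I. ?g (a i) ?B) + real k * ?g ?B ?B"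
    by (simp only: expand sum.distrib sum_subtractf I(1) sum_constant flip: sum_distrib_left)
  finally have "real k * ?g ?B ?B \<le> (\<Sum>i\<in>I. ?g (a i) (a i))" unfolding cross by simp
  then show ?thesis
    using I(2) by (simp only: tnorm_sq[OF X]) (simp add: pos_le_divide_eq mult.commute)
qed

text \<open>
  The batch mean is unbiased, so its centred version is orthogonal on average to the fixed vector \<open>u\<close>,
  and its variance is at most its second moment, which the convexity of the squared norm bounds by that
  of a single \<open>a i\<close>.
\<close>

lemma minibatch_variance:
  assumes X: "riemannian_manifold X" and b: "1 \<le> b" "b \<le> n"
  shows "(\<Sum>I\<in>minibatches n b.
            (tnorm X x ((\<Sum>i\<in>I. a i) /\<^sub>R real b - (\<Sum>i=1..n. a i) /\<^sub>R real n + u))\<^sup>2)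
            / real (card (minibatches n b))
          \<le> (\<Sum>i=1..n. (tnorm X x (a i))\<^sup>2) / real n + (tnorm X x u)\<^sup>2"
proof -
  let ?g = "metric X x"
  let ?N = "real (card (minibatches n b))"
  let ?B = "\<lambda>I. (\<Sum>i\<in>I. a i) /\<^sub>R real b"
  define A where "A = (\<Sum>i=1..n. a i) /\<^sub>R real n"
  note bil = metric_bilinear[OF X, of x]
  have lin: "linear (\<lambda>v. ?g v (u - A))" using bil by (simp add: bilinear_def)
  have "minibatches n b \<noteq> {}" using atLeastAtMost_in_minibatches[OF b(2)] by auto
  then have N: "?N > 0" using finite_minibatches by (simp add: card_gt_0_iff)
  have mean: "(\<Sum>I\<in>minibatches n b. ?B I) = ?N *\<^sub>R A"
    unfolding A_def minibatch_average[OF b, of a, symmetric] using N by simp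
  have "(\<Sum>I\<in>minibatches n b. ?g (?B I) (u - A)) = ?g (\<Sum>I\<in>minibatches n b. ?B I) (u - A)"
    by (rule linear_sum[OF lin, symmetric])
  also have "\<dots> = ?N * ?g A (u - A)" by (simp add: mean bilinear_lmul[OF bil])
  finally have cross: "(\<Sum>I\<in>minibatches n b. ?g (?B I) (u - A)) = ?N * ?g A (u - A)" .
  have expand: "(tnorm X x (B - A + u))\<^sup>2
      = (tnorm X x B)\<^sup>2 + 2 * ?g B (u - A) + ?g (u - A) (u - A)" for B
    using metric_sym[OF X, of x A B] metric_sym[OF X, of x u B] metric_sym[OF X, of x A u]
    by (simp add: tnorm_sq[OF X] bilinear_lsub[OF bil] bilinear_rsub[OF bil] bilinear_ladd[OF bil] bilinear_radd[OF bil])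
  have total: "(\<Sum>I\<in>minibatches n b. (tnorm X x (?B I - A + u))\<^sup>2)
      = (\<Sum>I\<in>minibatches n b. (tnorm X x (?B I))\<^sup>2) + 2 * (?N * ?g A (u - A)) + ?N * ?g (u - A) (u - A)"
    unfolding expand by (simp only: sum.distrib cross sum_constant flip: sum_distrib_left)
  have square: "2 * ?g A (u - A) + ?g (u - A) (u - A) = ?g u u - ?g A A"
    using metric_sym[OF X, of x u A]
    by (simp add: bilinear_lsub[OF bil] bilinear_rsub[OF bil])
  have le: "(\<Sum>I\<in>minibatches n b. (tnorm X x (?B I))\<^sup>2) / ?N
      \<le> (\<Sum>i=1..n. (tnorm X x (a i))\<^sup>2) / real n"
  proof -
    have "(\<Sum>I\<in>minibatches n b. (tnorm X x (?B I))\<^sup>2)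
        \<le> (\<Sum>I\<in>minibatches n b. (\<Sum>i\<in>I. (tnorm X x (a i))\<^sup>2) / real b)"
      by (intro sum_mono tnorm_mean_sq_le[OF X]) (use b in \<open>simp_all add: minibatches_def\<close>)
    then have "(\<Sum>I\<in>minibatches n b. (tnorm X x (?B I))\<^sup>2) / ?N
        \<le> (\<Sum>I\<in>minibatches n b. (\<Sum>i\<in>I. (tnorm X x (a i))\<^sup>2) / real b) / ?N"
      by (rule divide_right_mono) simp
    also have "\<dots> = (\<Sum>i=1..n. (tnorm X x (a i))\<^sup>2) / real n"
      using minibatch_average[OF b, of "\<lambda>i. (tnorm X x (a i))\<^sup>2"]
      by (simp add: divide_inverse mult.commute)
    finally show ?thesis .
  qed
  have "(\<Sum>I\<in>minibatches n b. (tnorm X x (?B I - A + u))\<^sup>2) / ?N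
      = (\<Sum>I\<in>minibatches n b. (tnorm X x (?B I))\<^sup>2) / ?N + (2 * ?g A (u - A) + ?g (u - A) (u - A))"
    unfolding total using N by (simp add: add_divide_distrib)
  then show ?thesis
    using le metric_nonneg[OF X, of x A] unfolding square by (simp add: A_def tnorm_sq[OF X])
qed


section \<open>The error of the directions\<close>

text \<open>
  The data of a run, separated from the assumptions so that these can be stated with the abbreviations for
  iterates and directions.  The step size is the constant \<open>h\<close>.
\<close>

locale hybrid_svrg_data =
  fixes X :: "('m::{t2_space, second_countable_topology}, 'e::euclidean_space) riem"
    and R :: "'m \<Rightarrow> 'e \<Rightarrow> 'm" and T :: "'m \<Rightarrow> 'e \<Rightarrow> 'e \<Rightarrow> 'e" and \<Gamma> :: "'m \<Rightarrow> 'm \<Rightarrow> 'e \<Rightarrow> 'e"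
    and f :: "'m \<Rightarrow> real" and fi :: "nat \<Rightarrow> 'm \<Rightarrow> real"
    and n b m :: nat and \<psi> :: "nat \<Rightarrow> nat \<Rightarrow> real" and w0 :: 'm and \<Omega> :: "'m set"
    and \<mu> \<rho> M \<theta> L C1 C2 \<delta> N h :: real
begin

abbreviation iter :: "(nat \<times> nat \<Rightarrow> nat set) \<Rightarrow> nat \<Rightarrow> nat \<Rightarrow> 'm" where
  "iter \<equiv> iterate X R T \<rho> f fi (\<lambda>_ _. h) \<mu> \<psi> m w0"

abbreviation dir :: "(nat \<times> nat \<Rightarrow> nat set) \<Rightarrow> nat \<Rightarrow> nat \<Rightarrow> 'e" where
  "dir \<equiv> direction X R T \<rho> f fi (\<lambda>_ _. h) \<mu> \<psi> m w0"

abbreviation hybrid :: "real \<Rightarrow> 'm \<Rightarrow> 'm \<Rightarrow> 'e \<Rightarrow> 'e \<Rightarrow> 'm \<Rightarrow> nat set \<Rightarrow> 'e" where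
  "hybrid \<equiv> hybrid_direction X R T \<rho> f fi \<mu>"

definition err :: "(nat \<times> nat \<Rightarrow> nat set) \<Rightarrow> nat \<Rightarrow> nat \<Rightarrow> real" where
  "err J s t = (tnorm X (iter J s t) (dir J s t - grad X f (iter J s t)))\<^sup>2"

definition dir_sq :: "(nat \<times> nat \<Rightarrow> nat set) \<Rightarrow> nat \<Rightarrow> nat \<Rightarrow> real" where
  "dir_sq J s t = (tnorm X (iter J s t) (dir J s t))\<^sup>2"

definition grad_sq :: "(nat \<times> nat \<Rightarrow> nat set) \<Rightarrow> nat \<Rightarrow> nat \<Rightarrow> real" where
  "grad_sq J s t = (tnorm X (iter J s t) (grad X f (iter J s t)))\<^sup>2"

lemma iter_Suc: "iter J s (Suc t) = R (iter J s t) (- (h *\<^sub>R dir J s t))"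
  by (simp add: iterate_def direction_def Let_def split: prod.split)

lemma dir_0: "dir J s 0 = grad X f (iter J s 0)"
  by (simp add: iterate_def direction_def)

lemma dir_Suc:
  "dir J s (Suc t) = hybrid (\<psi> s (Suc t)) (iter J s 0) (iter J s t) (dir J s t)
     (- (h *\<^sub>R dir J s t)) (iter J s (Suc t)) (J (s, Suc t))"
  by (simp add: iterate_def direction_def Let_def split: prod.split)

lemma iter_first: "iter J (Suc 0) 0 = w0"
  by (simp add: iterate_def)

lemma iter_next_epoch: "s \<ge> 1 \<Longrightarrow> iter J (Suc s) 0 = iter J s m"
  by (cases s) (simp_all add: iterate_def)

text \<open>
  The iterate in step \<open>t\<close> is determined by the index sets drawn before step \<open>t\<close>, the direction also depends
  on the one drawn in step \<open>t\<close>.  This takes the place of a filtration.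
\<close>

lemma epoch_step_cong:
  assumes "\<And>k. 1 \<le> k \<Longrightarrow> k \<le> t \<Longrightarrow> J (s, k) = J' (s, k)"
  shows "epoch_step X R T \<rho> f fi (\<lambda>_ _. h) \<mu> \<psi> J s x t = epoch_step X R T \<rho> f fi (\<lambda>_ _. h) \<mu> \<psi> J' s x t"
  using assms by (induction t) (simp_all add: le_SucI)

lemma fst_epoch_step_cong:
  assumes "\<And>k. 1 \<le> k \<Longrightarrow> k < t \<Longrightarrow> J (s, k) = J' (s, k)"
  shows "fst (epoch_step X R T \<rho> f fi (\<lambda>_ _. h) \<mu> \<psi> J s x t)
       = fst (epoch_step X R T \<rho> f fi (\<lambda>_ _. h) \<mu> \<psi> J' s x t)"
proof (cases t)
  case (Suc k)
  then show ?thesis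
    using epoch_step_cong[of k J s J' x] assms by (simp add: Let_def split: prod.split)
qed simp

lemma epoch_output_cong:
  assumes "\<And>r k. 1 \<le> r \<Longrightarrow> r \<le> s \<Longrightarrow> 1 \<le> k \<Longrightarrow> k < m \<Longrightarrow> J (r, k) = J' (r, k)"
  shows "epoch_output X R T \<rho> f fi (\<lambda>_ _. h) \<mu> \<psi> m w0 J s
       = epoch_output X R T \<rho> f fi (\<lambda>_ _. h) \<mu> \<psi> m w0 J' s"
  using assms
proof (induction s)
  case (Suc s)
  then have "epoch_output X R T \<rho> f fi (\<lambda>_ _. h) \<mu> \<psi> m w0 J s
       = epoch_output X R T \<rho> f fi (\<lambda>_ _. h) \<mu> \<psi> m w0 J' s" by simp
  with fst_epoch_step_cong[of m J "Suc s" J'] Suc.prems show ?case by simp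
qed simp

lemma iter_cong:
  assumes s: "1 \<le> s"
    and "\<And>r k. 1 \<le> r \<Longrightarrow> r < s \<Longrightarrow> 1 \<le> k \<Longrightarrow> k < m \<Longrightarrow> J (r, k) = J' (r, k)"
    and "\<And>k. 1 \<le> k \<Longrightarrow> k < t \<Longrightarrow> J (s, k) = J' (s, k)"
  shows "iter J s t = iter J' s t"
proof -
  have "epoch_output X R T \<rho> f fi (\<lambda>_ _. h) \<mu> \<psi> m w0 J (s - 1)
       = epoch_output X R T \<rho> f fi (\<lambda>_ _. h) \<mu> \<psi> m w0 J' (s - 1)"
    using assms by (intro epoch_output_cong) auto
  with fst_epoch_step_cong[of t J s J'] assms(3) show ?thesis by (simp add: iterate_def)
qed

lemma dir_cong:
  assumes s: "1 \<le> s"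
    and "\<And>r k. 1 \<le> r \<Longrightarrow> r < s \<Longrightarrow> 1 \<le> k \<Longrightarrow> k < m \<Longrightarrow> J (r, k) = J' (r, k)"
    and "\<And>k. 1 \<le> k \<Longrightarrow> k \<le> t \<Longrightarrow> J (s, k) = J' (s, k)"
  shows "dir J s t = dir J' s t"
proof -
  have "epoch_output X R T \<rho> f fi (\<lambda>_ _. h) \<mu> \<psi> m w0 J (s - 1)
       = epoch_output X R T \<rho> f fi (\<lambda>_ _. h) \<mu> \<psi> m w0 J' (s - 1)"
    using assms by (intro epoch_output_cong) auto
  with epoch_step_cong[of t J s J'] assms(3) show ?thesis by (simp add: direction_def)
qed

end

locale hybrid_svrg = hybrid_svrg_data X R T \<Gamma> f fi n b m \<psi> w0 \<Omega> \<mu> \<rho> M \<theta> L C1 C2 \<delta> N h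
  for X :: "('m::{t2_space, second_countable_topology}, 'e::euclidean_space) riem"
    and R T \<Gamma> f fi n b m \<psi> w0 \<Omega> \<mu> \<rho> M \<theta> L C1 C2 \<delta> N h +
  assumes manifold: "riemannian_manifold X"
    and retraction: "riemannian_retraction X R"
    and transport_linear: "\<And>x \<eta>. linear (T x \<eta>)"
    and isometric: "isometric_transport X R T"
    and b: "1 \<le> b" "b \<le> n"
    and f: "f = (\<lambda>x. (\<Sum>i=1..n. fi i x) / real n)"
    and C1_f: "C1_fun X f" and C1_fi: "\<And>i. i \<in> {1..n} \<Longrightarrow> C1_fun X (fi i)"
    and \<mu>: "0 < \<mu>"
    and \<psi>: "\<And>s t. s \<ge> 1 \<Longrightarrow> t < m \<Longrightarrow> 0 \<le> \<psi> s t \<and> \<psi> s t \<le> 1"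
    and in_\<Omega>: "\<And>J s t. J \<in> runs m n b \<Longrightarrow> s \<ge> 1 \<Longrightarrow> t \<le> m \<Longrightarrow> iter J s t \<in> \<Omega>"
    and \<rho>: "\<rho> > 0" "\<And>x. x \<in> \<Omega> \<Longrightarrow> diffeo_on_tball X R \<rho> x \<and> \<Omega> \<subseteq> R x ` tball X x \<rho>"
    and segment_in_\<Omega>: "\<And>J s t \<tau>. J \<in> runs m n b \<Longrightarrow> s \<ge> 1 \<Longrightarrow> t < m \<Longrightarrow> \<tau> \<in> {0..1} \<Longrightarrow>
           R (iter J s t) (- ((\<tau> * h) *\<^sub>R dir J s t)) \<in> \<Omega>"
    and M: "\<And>x y \<xi>. x \<in> \<Omega> \<Longrightarrow> y \<in> \<Omega> \<Longrightarrow> y = R x \<xi> \<Longrightarrow>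
           (\<Sum>i=1..n. (tnorm X x (grad X (fi i) x - \<Gamma> y x (grad X (fi i) y)))\<^sup>2) / real n
             \<le> M\<^sup>2 * (tnorm X x \<xi>)\<^sup>2"
    and \<theta>: "\<theta> > 0" "\<And>x y \<xi> \<eta>. x \<in> \<Omega> \<Longrightarrow> y \<in> \<Omega> \<Longrightarrow> y = R x \<xi> \<Longrightarrow>
           tnorm X y (\<Gamma> x y \<eta> - T x \<xi> \<eta>) \<le> \<theta> * tnorm X x \<xi> * tnorm X x \<eta>"
    and L: "\<And>x y \<xi>. x \<in> \<Omega> \<Longrightarrow> y \<in> \<Omega> \<Longrightarrow> y = R x \<xi> \<Longrightarrow>
           f y \<le> f x + metric X x (grad X f x) \<xi> + L / 2 * (tnorm X x \<xi>)\<^sup>2"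
    and C1C2: "C1 > 0" "C2 > 0"
         "\<And>x y \<xi>. x \<in> \<Omega> \<Longrightarrow> y \<in> \<Omega> \<Longrightarrow> y = R x \<xi> \<Longrightarrow> tnorm X x \<xi> \<le> \<delta> \<Longrightarrow>
           ennreal (tnorm X x \<xi>) \<le> ennreal C1 * rdist X x y \<and>
           rdist X x y \<le> ennreal (C2 * tnorm X x \<xi>)"
    and small_\<Omega>: "\<And>x y. x \<in> \<Omega> \<Longrightarrow> y \<in> \<Omega> \<Longrightarrow> tnorm X x (retr_inv X R \<rho> x y) \<le> \<delta>"
    and N: "N > 0" "\<And>x i. x \<in> \<Omega> \<Longrightarrow> i \<in> {1..n} \<Longrightarrow> tnorm X x (grad X (fi i) x) \<le> N"
    and h: "h > 0"
begin

lemma n_pos: "n \<ge> 1" using b by simp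

lemma retr_inv_works:
  assumes "x \<in> \<Omega>" "y \<in> \<Omega>"
  shows "R x (retr_inv X R \<rho> x y) = y"
  unfolding retr_inv_def using \<rho>(2)[OF assms(1)] assms(2) by (intro f_inv_into_f) auto

lemma tnorm_transport: "tnorm X (R x \<eta>) (T x \<eta> v) = tnorm X x v"
  using isometric by (simp add: isometric_transport_def tnorm_def)

lemma tnorm_le_dist:
  assumes "x \<in> \<Omega>" "y \<in> \<Omega>" "y = R x \<xi>" "tnorm X x \<xi> \<le> \<delta>" "rdist X x y \<le> ennreal D" "D \<ge> 0"
  shows "tnorm X x \<xi> \<le> C1 * D"
proof -
  have "ennreal (tnorm X x \<xi>) \<le> ennreal C1 * rdist X x y" using C1C2(3) assms by blast
  also have "\<dots> \<le> ennreal C1 * ennreal D" using assms(5) by (intro mult_left_mono) auto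
  also have "\<dots> = ennreal (C1 * D)" using C1C2(1) assms(6) by (simp add: ennreal_mult)
  finally show ?thesis using C1C2(1) assms(6) by (simp add: ennreal_le_iff)
qed

text \<open>
  The difference splits at \<open>\<Gamma> x y (grad X (fi i) x)\<close>.  The first part is a vector at \<open>y\<close>, so the Lipschitz
  assumption on the gradients is applied at \<open>y\<close> with a tangent vector \<open>\<xi>'\<close> at \<open>y\<close> retracted to \<open>x\<close>; its
  norm and that of \<open>\<xi>\<close> are both at most \<open>C1 * D\<close> by the symmetry of the distance.
\<close>

lemma gradient_transport_error:
  assumes x: "x \<in> \<Omega>" and y: "y \<in> \<Omega>" "y = R x \<xi>" and \<xi>: "tnorm X x \<xi> \<le> \<delta>"
    and D: "rdist X x y \<le> ennreal D" "D \<ge> 0"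
  shows "(\<Sum>i=1..n. (tnorm X y (grad X (fi i) y - T x \<xi> (grad X (fi i) x)))\<^sup>2) / real n
           \<le> 2 * (M\<^sup>2 + \<theta>\<^sup>2 * N\<^sup>2) * C1\<^sup>2 * D\<^sup>2"
proof -
  let ?g = "\<lambda>i. grad X (fi i)"
  define \<xi>' where "\<xi>' = retr_inv X R \<rho> y x"
  have \<xi>': "x = R y \<xi>'" "tnorm X y \<xi>' \<le> \<delta>"
    using retr_inv_works[OF y(1) x] small_\<Omega>[OF y(1) x] by (simp_all add: \<xi>'_def)
  have "rdist X y x \<le> ennreal D" using D(1) by (simp add: rdist_commute[OF manifold, of y])
  then have norm': "tnorm X y \<xi>' \<le> C1 * D" using tnorm_le_dist[OF y(1) x \<xi>'] D by blast
  have norm: "tnorm X x \<xi> \<le> C1 * D" using tnorm_le_dist[OF x y \<xi> D] .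
  have each: "(tnorm X y (?g i y - T x \<xi> (?g i x)))\<^sup>2
      \<le> 2 * (tnorm X y (?g i y - \<Gamma> x y (?g i x)))\<^sup>2 + 2 * (\<theta> * (C1 * D) * N)\<^sup>2" if i: "i \<in> {1..n}" for i
  proof -
    have "tnorm X y (\<Gamma> x y (?g i x) - T x \<xi> (?g i x)) \<le> \<theta> * tnorm X x \<xi> * tnorm X x (?g i x)"
      by (rule \<theta>(2)[OF x y])
    also have "\<dots> \<le> \<theta> * (C1 * D) * N"
      using norm N(2)[OF x i] \<theta>(1) tnorm_nonneg[OF manifold] C1C2 D
      by (intro mult_mono mult_left_mono mult_nonneg_nonneg) auto
    finally have "(tnorm X y (\<Gamma> x y (?g i x) - T x \<xi> (?g i x)))\<^sup>2 \<le> (\<theta> * (C1 * D) * N)\<^sup>2"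
      using tnorm_nonneg[OF manifold] by (intro power_mono) auto
    then show ?thesis
      using tnorm_add_sq_le[OF manifold, of y "?g i y - \<Gamma> x y (?g i x)" "\<Gamma> x y (?g i x) - T x \<xi> (?g i x)"]
      by simp
  qed
  have "(\<Sum>i=1..n. (tnorm X y (?g i y - T x \<xi> (?g i x)))\<^sup>2)
      \<le> (\<Sum>i=1..n. 2 * (tnorm X y (?g i y - \<Gamma> x y (?g i x)))\<^sup>2 + 2 * (\<theta> * (C1 * D) * N)\<^sup>2)"
    by (rule sum_mono) (rule each)
  also have "\<dots> = 2 * (\<Sum>i=1..n. (tnorm X y (?g i y - \<Gamma> x y (?g i x)))\<^sup>2) + real n * (2 * (\<theta> * (C1 * D) * N)\<^sup>2)"
    by (simp add: sum.distrib sum_distrib_left)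
  finally have "(\<Sum>i=1..n. (tnorm X y (?g i y - T x \<xi> (?g i x)))\<^sup>2) / real n
      \<le> 2 * ((\<Sum>i=1..n. (tnorm X y (?g i y - \<Gamma> x y (?g i x)))\<^sup>2) / real n) + 2 * (\<theta> * (C1 * D) * N)\<^sup>2"
    using n_pos by (simp add: field_simps)
  also have "\<dots> \<le> 2 * (M\<^sup>2 * (C1 * D)\<^sup>2) + 2 * (\<theta> * (C1 * D) * N)\<^sup>2"
  proof -
    have "(\<Sum>i=1..n. (tnorm X y (?g i y - \<Gamma> x y (?g i x)))\<^sup>2) / real n \<le> M\<^sup>2 * (tnorm X y \<xi>')\<^sup>2"
      by (rule M[OF y(1) x \<xi>'(1)])
    also have "\<dots> \<le> M\<^sup>2 * (C1 * D)\<^sup>2"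
      using norm' tnorm_nonneg[OF manifold] by (intro mult_left_mono power_mono) auto
    finally show ?thesis by simp
  qed
  finally show ?thesis by (simp add: power_mult_distrib algebra_simps)
qed

text \<open>
  The contribution of the index \<open>i\<close> to the random part of the direction.
\<close>

definition hybrid_summand :: "real \<Rightarrow> 'm \<Rightarrow> 'm \<Rightarrow> 'e \<Rightarrow> 'm \<Rightarrow> nat \<Rightarrow> 'e" where
  "hybrid_summand q x0 x \<eta> y i =
     (1 - q) *\<^sub>R (grad X (fi i) y - T x0 (retr_inv X R \<rho> x0 y) (grad X (fi i) x0))
     + q *\<^sub>R (grad X (fi i) y - T x \<eta> (grad X (fi i) x))"

text \<open>
  In both estimators the gradients of \<open>f\<close> at the old points complete the batch averages to centred ones;
  only the transported error of the previous direction is left over from the recursive estimator.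
\<close>

lemma hybrid_direction_error:
  assumes p: "0 \<le> p" "p \<le> 1"
  obtains q where "0 \<le> q" "q \<le> 1"
    "\<And>I. I \<in> minibatches n b \<Longrightarrow> hybrid p x0 x v \<eta> y I - grad X f y =
       (\<Sum>i\<in>I. hybrid_summand q x0 x \<eta> y i) /\<^sub>R real b
       - (\<Sum>i=1..n. hybrid_summand q x0 x \<eta> y i) /\<^sub>R real n
       + q *\<^sub>R T x \<eta> (v - grad X f x)"
proof -
  define D where "D = metric X y (T x \<eta> (v - grad X f x)) (grad X f y)"
  define q where "q = (if D \<noteq> 0 then min p (\<mu> * (tnorm X y (grad X f y))\<^sup>2 / \<bar>D\<bar>) else p)"
  let ?T0 = "T x0 (retr_inv X R \<rho> x0 y)"
  let ?T1 = "T x \<eta>"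
  have "0 \<le> q" "q \<le> 1" using p \<mu> by (auto simp: q_def)
  moreover have "hybrid p x0 x v \<eta> y I - grad X f y =
       (\<Sum>i\<in>I. hybrid_summand q x0 x \<eta> y i) /\<^sub>R real b
       - (\<Sum>i=1..n. hybrid_summand q x0 x \<eta> y i) /\<^sub>R real n
       + q *\<^sub>R T x \<eta> (v - grad X f x)" if I: "I \<in> minibatches n b" for I
  proof -
    have mean: "(\<Sum>i\<in>K. hybrid_summand q x0 x \<eta> y i) /\<^sub>R k =
        (1 - q) *\<^sub>R ((\<Sum>i\<in>K. grad X (fi i) y) /\<^sub>R k - ?T0 ((\<Sum>i\<in>K. grad X (fi i) x0) /\<^sub>R k))
        + q *\<^sub>R ((\<Sum>i\<in>K. grad X (fi i) y) /\<^sub>R k - ?T1 ((\<Sum>i\<in>K. grad X (fi i) x) /\<^sub>R k))" for K and k :: real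
      unfolding hybrid_summand_def
      by (simp add: sum.distrib sum_subtractf linear_sum[OF transport_linear] linear_cmul[OF transport_linear]
          scaleR_right_diff_distrib scaleR_add_right scaleR_sum_right mult.commute)
    have card: "real (card I) = real b" using I by (simp add: minibatches_def)
    have hyb: "hybrid p x0 x v \<eta> y I =
        (1 - q) *\<^sub>R (batch_grad X fi I y - ?T0 (batch_grad X fi I x0 - grad X f x0))
        + q *\<^sub>R (batch_grad X fi I y - ?T1 (batch_grad X fi I x - v))"
      unfolding hybrid_direction_def D_def[symmetric] q_def by (simp add: Let_def)
    have full: "(\<Sum>i=1..n. grad X (fi i) z) /\<^sub>R real n = grad X f z" for z
      using grad_average[OF manifold C1_fi f C1_f, of z] by simp
    have batch: "(\<Sum>i\<in>I. grad X (fi i) z) /\<^sub>R real b = batch_grad X fi I z" for z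
      by (simp add: batch_grad_def card)
    show ?thesis
      unfolding mean full batch hyb linear_diff[OF transport_linear]
      by (simp add: algebra_simps)
  qed
  ultimately show ?thesis by (rule that)
qed

text \<open>
  Both estimators compare gradients at points within \<open>D\<close> of \<open>y\<close>, so by convexity the bound does not depend
  on the weight \<open>q\<close>, and the inherited error is only shrunk by it.
\<close>

lemma hybrid_direction_variance:
  assumes p: "0 \<le> p" "p \<le> 1" and x0: "x0 \<in> \<Omega>" and x: "x \<in> \<Omega>" and y: "y \<in> \<Omega>" "y = R x \<eta>"
    and \<eta>: "tnorm X x \<eta> \<le> \<delta>"
    and D: "rdist X x0 y \<le> ennreal D" "rdist X x y \<le> ennreal D" "D \<ge> 0"
  shows "(\<Sum>I\<in>minibatches n b. (tnorm X y (hybrid p x0 x v \<eta> y I - grad X f y))\<^sup>2)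
            / real (card (minibatches n b))
          \<le> 2 * (M\<^sup>2 + \<theta>\<^sup>2 * N\<^sup>2) * C1\<^sup>2 * D\<^sup>2 + (tnorm X x (v - grad X f x))\<^sup>2"
proof -
  obtain q where q: "0 \<le> q" "q \<le> 1"
    and hyb: "\<And>I. I \<in> minibatches n b \<Longrightarrow> hybrid p x0 x v \<eta> y I - grad X f y =
       (\<Sum>i\<in>I. hybrid_summand q x0 x \<eta> y i) /\<^sub>R real b
       - (\<Sum>i=1..n. hybrid_summand q x0 x \<eta> y i) /\<^sub>R real n
       + q *\<^sub>R T x \<eta> (v - grad X f x)"
    using hybrid_direction_error[OF p, of x0 x v \<eta> y] by blast
  let ?A = "\<lambda>i. (tnorm X y (grad X (fi i) y - T x0 (retr_inv X R \<rho> x0 y) (grad X (fi i) x0)))\<^sup>2"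
  let ?B = "\<lambda>i. (tnorm X y (grad X (fi i) y - T x \<eta> (grad X (fi i) x)))\<^sup>2"
  let ?K = "2 * (M\<^sup>2 + \<theta>\<^sup>2 * N\<^sup>2) * C1\<^sup>2 * D\<^sup>2"
  have A: "(\<Sum>i=1..n. ?A i) / real n \<le> ?K"
    using gradient_transport_error[OF x0 y(1) retr_inv_works[OF x0 y(1), symmetric]
        small_\<Omega>[OF x0 y(1)] D(1,3)] .
  have B: "(\<Sum>i=1..n. ?B i) / real n \<le> ?K"
    using gradient_transport_error[OF x y \<eta> D(2,3)] .
  have "(\<Sum>i=1..n. (tnorm X y (hybrid_summand q x0 x \<eta> y i))\<^sup>2)
      \<le> (\<Sum>i=1..n. (1 - q) * ?A i + q * ?B i)"
    unfolding hybrid_summand_def by (intro sum_mono tnorm_convex_sq[OF manifold q])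
  then have "(\<Sum>i=1..n. (tnorm X y (hybrid_summand q x0 x \<eta> y i))\<^sup>2) / real n
      \<le> (\<Sum>i=1..n. (1 - q) * ?A i + q * ?B i) / real n"
    by (rule divide_right_mono) simp
  also have "\<dots> = (1 - q) * ((\<Sum>i=1..n. ?A i) / real n) + q * ((\<Sum>i=1..n. ?B i) / real n)"
    by (simp only: sum.distrib sum_distrib_left add_divide_distrib times_divide_eq_right)
  also have "\<dots> \<le> (1 - q) * ?K + q * ?K"
    using q A B by (intro add_mono mult_left_mono) auto
  also have "\<dots> = ?K" by (simp add: algebra_simps)
  finally have main: "(\<Sum>i=1..n. (tnorm X y (hybrid_summand q x0 x \<eta> y i))\<^sup>2) / real n \<le> ?K" .
  have "tnorm X y (q *\<^sub>R T x \<eta> (v - grad X f x)) = q * tnorm X x (v - grad X f x)"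
    using q by (simp add: tnorm_scaleR[OF manifold] y(2) tnorm_transport)
  moreover have "\<dots> \<le> tnorm X x (v - grad X f x)"
    using q tnorm_nonneg[OF manifold] by (intro mult_left_le_one_le)
  ultimately have "(tnorm X y (q *\<^sub>R T x \<eta> (v - grad X f x)))\<^sup>2 \<le> (tnorm X x (v - grad X f x))\<^sup>2"
    using q tnorm_nonneg[OF manifold] by (intro power_mono) auto
  with main minibatch_variance[OF manifold b, of y "hybrid_summand q x0 x \<eta> y" "q *\<^sub>R T x \<eta> (v - grad X f x)"]
  show ?thesis by (simp add: hyb)
qed

end


section \<open>Accumulated error and descent along a run\<close>

text \<open>
  A discrete Gronwall argument without exponential loss: the increments involve \<open>v\<close> but not \<open>a\<close>, so
  \<open>t\<close> of them, each at most \<open>c m\<close> times the sum of all \<open>v\<close>, are simply added.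
\<close>

lemma sum_le_of_linear_growth:
  fixes a v :: "nat \<Rightarrow> real"
  assumes a0: "a 0 = 0" and v: "\<And>t. v t \<ge> 0" and c: "c \<ge> 0"
    and step: "\<And>t. Suc t < m \<Longrightarrow> a (Suc t) \<le> c * real (Suc t) * (\<Sum>i\<le>t. v i) + a t"
  shows "(\<Sum>t<m. a t) \<le> c * real m ^ 3 * (\<Sum>t<m. v t)"
proof -
  let ?W = "\<Sum>t<m. v t"
  have W: "?W \<ge> 0" by (intro sum_nonneg v)
  have a: "a t \<le> real t * (c * real m * ?W)" if "t < m" for t
    using that
  proof (induction t)
    case (Suc t)
    have "c * real (Suc t) * (\<Sum>i\<le>t. v i) \<le> c * real m * ?W"
      using Suc.prems c v W
      by (intro mult_mono mult_nonneg_nonneg mult_left_mono sum_mono2 sum_nonneg) auto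
    moreover have "a t \<le> real t * (c * real m * ?W)" using Suc by simp
    ultimately show ?case using step[OF Suc.prems] by (simp add: algebra_simps)
  qed (simp add: a0)
  have "a t \<le> real m * (c * real m * ?W)" if "t < m" for t
  proof -
    have "real t * (c * real m * ?W) \<le> real m * (c * real m * ?W)"
      using that c W by (intro mult_right_mono mult_nonneg_nonneg) auto
    with a[OF that] show ?thesis by linarith
  qed
  then have "(\<Sum>t<m. a t) \<le> (\<Sum>t<m. real m * (c * real m * ?W))" by (intro sum_mono) auto
  then show ?thesis by (simp add: power3_eq_cube algebra_simps)
qed

context hybrid_svrg
begin

definition \<kappa> :: real where "\<kappa> = 2 * (M\<^sup>2 + \<theta>\<^sup>2 * N\<^sup>2) * C1\<^sup>2 * C2\<^sup>2 * h\<^sup>2"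

lemma \<kappa>_nonneg: "\<kappa> \<ge> 0" by (simp add: \<kappa>_def)

text \<open>
  Since the step stays in the ball where the retraction is invertible, it is the value of the local
  inverse, and the smallness of \<open>\<Omega>\<close> applies to it.
\<close>

lemma step_length:
  assumes J: "J \<in> runs m n b" and s: "s \<ge> 1" and t: "t < m"
  shows "tnorm X (iter J s t) (- (h *\<^sub>R dir J s t)) \<le> \<delta>"
proof -
  let ?x = "iter J s t"
  let ?v = "- (h *\<^sub>R dir J s t)"
  have x: "?x \<in> \<Omega>" using in_\<Omega>[OF J s] t by simp
  have y: "R ?x ?v \<in> \<Omega>" using in_\<Omega>[OF J s, of "Suc t"] t by (simp add: iter_Suc)
  have diffeo: "diffeo_on_tball X R \<rho> ?x" and sub: "\<Omega> \<subseteq> R ?x ` tball X ?x \<rho>" using \<rho>(2)[OF x] by auto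
  have "R ?x (\<tau> *\<^sub>R ?v) \<in> R ?x ` tball X ?x \<rho>" if "\<tau> \<in> {0..1}" for \<tau>
    using segment_in_\<Omega>[OF J s t that] sub by auto
  then have "?v \<in> tball X ?x \<rho>"
    by (rule ray_in_tball[OF manifold retraction diffeo \<rho>(1)])
  then have "retr_inv X R \<rho> ?x (R ?x ?v) = ?v"
    unfolding retr_inv_def using diffeo by (intro inv_into_f_f) (auto simp: diffeo_on_tball_def)
  then show ?thesis using small_\<Omega>[OF x y] by simp
qed

lemma rdist_step:
  assumes J: "J \<in> runs m n b" and s: "s \<ge> 1" and t: "t < m"
  shows "rdist X (iter J s t) (iter J s (Suc t)) \<le> ennreal (C2 * h * tnorm X (iter J s t) (dir J s t))"
proof -
  have "iter J s t \<in> \<Omega>" "iter J s (Suc t) \<in> \<Omega>" using in_\<Omega>[OF J s] t by simp_all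
  from C1C2(3)[OF this iter_Suc step_length[OF J s t]]
  show ?thesis using h by (simp add: tnorm_minus[OF manifold] tnorm_scaleR[OF manifold] mult.assoc)
qed

lemma rdist_epoch:
  assumes J: "J \<in> runs m n b" and s: "s \<ge> 1" and t: "t \<le> m"
  shows "rdist X (iter J s 0) (iter J s t)
           \<le> ennreal (\<Sum>i<t. C2 * h * tnorm X (iter J s i) (dir J s i))"
  using t
proof (induction t)
  case 0
  show ?case unfolding rdist_def by (rule INF_lower2[of 0]) (auto intro: pw_C1_path.intros)
next
  case (Suc t)
  have nonneg: "C2 * h * tnorm X (iter J s i) (dir J s i) \<ge> 0" for i
    using C1C2 h tnorm_nonneg[OF manifold] by simp
  have "rdist X (iter J s 0) (iter J s (Suc t))
      \<le> rdist X (iter J s 0) (iter J s t) + rdist X (iter J s t) (iter J s (Suc t))"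
    by (rule rdist_triangle)
  also have "\<dots> \<le> ennreal (\<Sum>i<t. C2 * h * tnorm X (iter J s i) (dir J s i))
      + ennreal (C2 * h * tnorm X (iter J s t) (dir J s t))"
    using Suc rdist_step[OF J s, of t] by (intro add_mono) auto
  also have "\<dots> = ennreal (\<Sum>i<Suc t. C2 * h * tnorm X (iter J s i) (dir J s i))"
    using nonneg by (simp add: sum_nonneg flip: ennreal_plus)
  finally show ?case .
qed

text \<open>
  The error of the next direction, averaged over the index set drawn for it, with the past fixed.  The
  square of the length of the path travelled in the epoch is where the factor \<open>Suc t\<close> arises, by the
  Cauchy-Schwarz inequality.
\<close>

lemma err_step:
  assumes J: "J \<in> runs m n b" and s: "s \<ge> 1" and t: "Suc t < m"
  shows "(\<Sum>I\<in>minibatches n b. err (J((s, Suc t) := I)) s (Suc t)) / real (card (minibatches n b))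
           \<le> \<kappa> * real (Suc t) * (\<Sum>i\<le>t. dir_sq J s i) + err J s t"
proof -
  define len where "len i = C2 * h * tnorm X (iter J s i) (dir J s i)" for i
  define D where "D = (\<Sum>i\<le>t. len i)"
  have len: "len i \<ge> 0" for i using C1C2 h tnorm_nonneg[OF manifold] by (simp add: len_def)
  have D: "D \<ge> 0" unfolding D_def by (intro sum_nonneg len)
  let ?x = "iter J s t" let ?y = "iter J s (Suc t)" let ?z = "iter J s 0"
  let ?\<eta> = "- (h *\<^sub>R dir J s t)"
  have mem: "?z \<in> \<Omega>" "?x \<in> \<Omega>" "?y \<in> \<Omega>" using in_\<Omega>[OF J s] t by simp_all
  have d0: "rdist X ?z ?y \<le> ennreal D"
    using rdist_epoch[OF J s, of "Suc t"] t by (simp add: D_def len_def lessThan_Suc_atMost)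
  have d1: "rdist X ?x ?y \<le> ennreal D"
  proof -
    have "rdist X ?x ?y \<le> ennreal (len t)" using rdist_step[OF J s, of t] t by (simp add: len_def)
    also have "\<dots> \<le> ennreal D" unfolding D_def by (intro ennreal_leI member_le_sum len) auto
    finally show ?thesis .
  qed
  \<comment> \<open>Redrawing the index set of step \<open>Suc t\<close> leaves everything but that direction unchanged.\<close>
  have err: "err (J((s, Suc t) := I)) s (Suc t)
      = (tnorm X ?y (hybrid (\<psi> s (Suc t)) ?z ?x (dir J s t) ?\<eta> ?y I - grad X f ?y))\<^sup>2" for I
  proof -
    have it: "iter (J((s, Suc t) := I)) s k = iter J s k" if "k \<le> Suc t" for k
      using that s by (intro iter_cong) auto
    have "dir (J((s, Suc t) := I)) s t = dir J s t" using s by (intro dir_cong) auto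
    then show ?thesis by (simp add: err_def dir_Suc it)
  qed
  have "(\<Sum>I\<in>minibatches n b. err (J((s, Suc t) := I)) s (Suc t)) / real (card (minibatches n b))
      \<le> 2 * (M\<^sup>2 + \<theta>\<^sup>2 * N\<^sup>2) * C1\<^sup>2 * D\<^sup>2 + err J s t"
    unfolding err err_def[of J]
    using \<psi>[OF s t] step_length[OF J s, of t] t mem d0 d1 D
    by (intro hybrid_direction_variance) (auto simp: iter_Suc)
  moreover have "2 * (M\<^sup>2 + \<theta>\<^sup>2 * N\<^sup>2) * C1\<^sup>2 * D\<^sup>2
      \<le> 2 * (M\<^sup>2 + \<theta>\<^sup>2 * N\<^sup>2) * C1\<^sup>2 * (C2\<^sup>2 * h\<^sup>2 * (real (Suc t) * (\<Sum>i\<le>t. dir_sq J s i)))"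
  proof (rule mult_left_mono)
    have "D\<^sup>2 \<le> (\<Sum>i\<le>t. (len i)\<^sup>2) * real (card {..t})"
      unfolding D_def by (rule sum_squared_le_sum_of_squares)
    then show "D\<^sup>2 \<le> C2\<^sup>2 * h\<^sup>2 * (real (Suc t) * (\<Sum>i\<le>t. dir_sq J s i))"
      by (simp add: len_def dir_sq_def power_mult_distrib sum_distrib_left mult_ac)
  qed simp
  ultimately show ?thesis by (simp only: \<kappa>_def mult.assoc)
qed

text \<open>
  The inner product of gradient and direction is expressed by the three squared norms; unlike in an
  unbiased method, the error is carried along.
\<close>

lemma descent:
  assumes J: "J \<in> runs m n b" and s: "s \<ge> 1" and t: "t < m"
  shows "f (iter J s (Suc t)) \<le> f (iter J s t) - h / 2 * grad_sq J s t
           - h / 2 * (1 - L * h) * dir_sq J s t + h / 2 * err J s t"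
proof -
  let ?x = "iter J s t" let ?v = "dir J s t" let ?g = "grad X f ?x"
  note bil = metric_bilinear[OF manifold, of ?x]
  have mem: "?x \<in> \<Omega>" "iter J s (Suc t) \<in> \<Omega>" using in_\<Omega>[OF J s] t by simp_all
  have "f (iter J s (Suc t)) \<le> f ?x + metric X ?x ?g (- (h *\<^sub>R ?v)) + L / 2 * (tnorm X ?x (- (h *\<^sub>R ?v)))\<^sup>2"
    by (rule L[OF mem iter_Suc])
  also have "metric X ?x ?g (- (h *\<^sub>R ?v)) = - h * metric X ?x ?g ?v"
    by (simp add: bilinear_rneg[OF bil] bilinear_rmul[OF bil])
  also have "(tnorm X ?x (- (h *\<^sub>R ?v)))\<^sup>2 = h\<^sup>2 * dir_sq J s t"
    by (simp add: tnorm_minus[OF manifold] tnorm_scaleR[OF manifold] dir_sq_def power_mult_distrib)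
  also have "err J s t = dir_sq J s t - 2 * metric X ?x ?g ?v + grad_sq J s t"
    using metric_sym[OF manifold, of ?x ?v ?g]
    by (simp add: err_def dir_sq_def grad_sq_def tnorm_sq[OF manifold] bilinear_lsub[OF bil] bilinear_rsub[OF bil])
  then have "metric X ?x ?g ?v = (dir_sq J s t + grad_sq J s t - err J s t) / 2" by simp
  finally show ?thesis by (simp add: algebra_simps power2_eq_square add_divide_distrib diff_divide_distrib)
qed

end

section \<open>Taking expectations\<close>

text \<open>
  Redrawing one coordinate of an independent family does not change its law.  Together with the locality of
  iterates and directions this replaces conditioning on the past.
\<close>

lemma Pi_pmf_resample:
  assumes A: "finite A" "k \<in> A"
  shows "Pi_pmf A d p = bind_pmf (Pi_pmf A d p) (\<lambda>J. map_pmf (\<lambda>I. J(k := I)) (p k))"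
proof -
  define Q where "Q = Pi_pmf (A - {k}) d p"
  have P: "Pi_pmf A d p = bind_pmf (p k) (\<lambda>y. bind_pmf Q (\<lambda>g. return_pmf (g(k := y))))"
    unfolding Q_def using Pi_pmf_insert'[of "A - {k}" k d p] A by (simp add: insert_absorb)
  show ?thesis
    unfolding P
    by (simp add: bind_assoc_pmf bind_return_pmf map_pmf_def)
      (subst bind_commute_pmf, rule refl)
qed

lemma expectation_Pi_pmf_resample:
  fixes F :: "('a \<Rightarrow> 'b) \<Rightarrow> real"
  assumes A: "finite A" "k \<in> A" and B: "\<And>i. i \<in> A \<Longrightarrow> finite (B i) \<and> B i \<noteq> {}"
  shows "measure_pmf.expectation (Pi_pmf A d (\<lambda>i. pmf_of_set (B i))) F
       = measure_pmf.expectation (Pi_pmf A d (\<lambda>i. pmf_of_set (B i)))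
           (\<lambda>J. (\<Sum>I\<in>B k. F (J(k := I))) / real (card (B k)))"
proof -
  let ?P = "Pi_pmf A d (\<lambda>i. pmf_of_set (B i))"
  have fin: "finite (set_pmf ?P)"
    using A B by (auto simp: set_Pi_pmf)
  have Bk: "finite (B k)" "B k \<noteq> {}" using B[OF A(2)] by auto
  have "measure_pmf.expectation ?P F
      = measure_pmf.expectation (bind_pmf ?P (\<lambda>J. map_pmf (\<lambda>I. J(k := I)) (pmf_of_set (B k)))) F"
    by (subst Pi_pmf_resample[OF A]) (rule refl)
  also have "\<dots> = (\<Sum>J\<in>set_pmf ?P. pmf ?P J *\<^sub>R
      measure_pmf.expectation (map_pmf (\<lambda>I. J(k := I)) (pmf_of_set (B k))) F)"
    using fin Bk by (intro pmf_expectation_bind) auto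
  also have "\<dots> = (\<Sum>J\<in>set_pmf ?P. pmf ?P J *\<^sub>R ((\<Sum>I\<in>B k. F (J(k := I))) / real (card (B k))))"
    using Bk by (simp add: integral_pmf_of_set)
  also have "\<dots> = measure_pmf.expectation ?P (\<lambda>J. (\<Sum>I\<in>B k. F (J(k := I))) / real (card (B k)))"
    using fin by (subst integral_measure_pmf[of "set_pmf ?P"]) auto
  finally show ?thesis .
qed

context hybrid_svrg
begin

text \<open>
  The default index set \<open>{1..b}\<close> differs from the one of \<open>run_pmf\<close>, which is empty: with it, every family
  in the support is a possible infinite run, to which the assumptions on \<open>\<Omega>\<close> apply.
\<close>

definition batches :: "nat \<Rightarrow> (nat \<times> nat \<Rightarrow> nat set) pmf" where
  "batches S = Pi_pmf ({1..S} \<times> {1..<m}) {1..b} (\<lambda>_. pmf_of_set (minibatches n b))"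

abbreviation expect :: "nat \<Rightarrow> ((nat \<times> nat \<Rightarrow> nat set) \<Rightarrow> real) \<Rightarrow> real" where
  "expect S F \<equiv> measure_pmf.expectation (batches S) F"

lemma minibatches_nonempty: "minibatches n b \<noteq> {}"
  using atLeastAtMost_in_minibatches[OF b(2)] by auto

lemma finite_set_batches: "finite (set_pmf (batches S))"
  by (auto simp: batches_def set_Pi_pmf finite_minibatches minibatches_nonempty)

lemma batches_in_runs:
  assumes "J \<in> set_pmf (batches S)"
  shows "J \<in> runs m n b"
proof -
  have "J (s, t) \<in> minibatches n b" for s t
    using assms atLeastAtMost_in_minibatches[OF b(2)]
    by (cases "(s, t) \<in> {1..S} \<times> {1..<m}")
      (auto simp: batches_def set_Pi_pmf PiE_dflt_def finite_minibatches minibatches_nonempty)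
  then show ?thesis by (simp add: runs_def)
qed

lemma integrable_batches [simp]: "integrable (measure_pmf (batches S)) (F :: _ \<Rightarrow> real)"
  by (rule integrable_measure_pmf_finite[OF finite_set_batches])

lemma expect_mono:
  assumes "\<And>J. J \<in> runs m n b \<Longrightarrow> F J \<le> G J"
  shows "expect S F \<le> expect S G"
  by (rule integral_mono_AE) (auto simp: AE_measure_pmf_iff intro: assms batches_in_runs)

lemma expect_err_step:
  assumes s: "s \<in> {1..S}" and t: "Suc t < m"
  shows "expect S (\<lambda>J. err J s (Suc t))
           \<le> \<kappa> * real (Suc t) * (\<Sum>i\<le>t. expect S (\<lambda>J. dir_sq J s i)) + expect S (\<lambda>J. err J s t)"
proof -
  have "expect S (\<lambda>J. err J s (Suc t)) = expect S (\<lambda>J.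
      (\<Sum>I\<in>minibatches n b. err (J((s, Suc t) := I)) s (Suc t)) / real (card (minibatches n b)))"
    unfolding batches_def using s t finite_minibatches minibatches_nonempty
    by (intro expectation_Pi_pmf_resample) auto
  also have "\<dots> \<le> expect S (\<lambda>J. \<kappa> * real (Suc t) * (\<Sum>i\<le>t. dir_sq J s i) + err J s t)"
    using s t by (intro expect_mono err_step) auto
  also have "\<dots> = \<kappa> * real (Suc t) * (\<Sum>i\<le>t. expect S (\<lambda>J. dir_sq J s i)) + expect S (\<lambda>J. err J s t)"
    by simp
  finally show ?thesis .
qed

text \<open>
  The step size makes the accumulated error no larger than what the squared directions gain.
\<close>

lemma epoch_progress:
  assumes step_size: "\<kappa> * real m ^ 3 \<le> 1 - L * h" and s: "s \<in> {1..S}"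
  shows "(\<Sum>t<m. expect S (\<lambda>J. grad_sq J s t))
           \<le> 2 / h * (expect S (\<lambda>J. f (iter J s 0)) - expect S (\<lambda>J. f (iter J s m)))"
proof -
  define F where "F t = expect S (\<lambda>J. f (iter J s t))" for t
  define G where "G t = expect S (\<lambda>J. grad_sq J s t)" for t
  define v where "v t = expect S (\<lambda>J. dir_sq J s t)" for t
  define a where "a t = expect S (\<lambda>J. err J s t)" for t
  have v: "v t \<ge> 0" for t unfolding v_def dir_sq_def by simp
  have "(\<Sum>t<m. a t) \<le> \<kappa> * real m ^ 3 * (\<Sum>t<m. v t)"
  proof (rule sum_le_of_linear_growth)
    show "a 0 = 0" by (simp add: a_def err_def dir_0 tnorm_def bilinear_lzero[OF metric_bilinear[OF manifold]])
    show "a (Suc t) \<le> \<kappa> * real (Suc t) * (\<Sum>i\<le>t. v i) + a t" if "Suc t < m" for t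
      unfolding a_def v_def by (rule expect_err_step[OF s that])
  qed (use v \<kappa>_nonneg in auto)
  also have "\<dots> \<le> (1 - L * h) * (\<Sum>t<m. v t)"
    using step_size v by (intro mult_right_mono sum_nonneg)
  finally have av: "(\<Sum>t<m. a t) \<le> (1 - L * h) * (\<Sum>t<m. v t)" .
  have "F (Suc t) - F t \<le> h / 2 * a t - h / 2 * (1 - L * h) * v t - h / 2 * G t" if t: "t < m" for t
  proof -
    have "F (Suc t) \<le> expect S (\<lambda>J. f (iter J s t) - h / 2 * grad_sq J s t
           - h / 2 * (1 - L * h) * dir_sq J s t + h / 2 * err J s t)"
      unfolding F_def using s t by (intro expect_mono descent) auto
    also have "\<dots> = F t - h / 2 * G t - h / 2 * (1 - L * h) * v t + h / 2 * a t"
      by (simp add: F_def G_def v_def a_def)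
    finally show ?thesis by simp
  qed
  then have "(\<Sum>t<m. F (Suc t) - F t)
      \<le> (\<Sum>t<m. h / 2 * a t - h / 2 * (1 - L * h) * v t - h / 2 * G t)"
    by (intro sum_mono) auto
  then have "F m - F 0 \<le> h / 2 * (\<Sum>t<m. a t) - h / 2 * (1 - L * h) * (\<Sum>t<m. v t) - h / 2 * (\<Sum>t<m. G t)"
    unfolding sum_lessThan_telescope by (simp only: sum_subtractf sum_distrib_left)
  also have "\<dots> = h / 2 * ((\<Sum>t<m. a t) - (1 - L * h) * (\<Sum>t<m. v t)) - h / 2 * (\<Sum>t<m. G t)"
    by (simp add: field_simps)
  also have "\<dots> \<le> - (h / 2 * (\<Sum>t<m. G t))"
    using av h by (simp add: mult_nonneg_nonpos)
  finally have "h / 2 * (\<Sum>t<m. G t) \<le> F 0 - F m" by simp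
  then show ?thesis using h by (simp add: F_def G_def field_simps)
qed

lemma total_progress:
  assumes step_size: "\<kappa> * real m ^ 3 \<le> 1 - L * h" and lower: "\<And>x. c \<le> f x"
  shows "(\<Sum>s=1..S. \<Sum>t<m. expect S (\<lambda>J. grad_sq J s t)) \<le> 2 / h * (f w0 - c)"
proof -
  define u where "u s = expect S (\<lambda>J. f (iter J s 0))" for s
  have "(\<Sum>s=1..S. \<Sum>t<m. expect S (\<lambda>J. grad_sq J s t)) \<le> (\<Sum>s=1..S. 2 / h * (u s - u (Suc s)))"
  proof (rule sum_mono)
    fix s assume s: "s \<in> {1..S}"
    with epoch_progress[OF step_size s]
    show "(\<Sum>t<m. expect S (\<lambda>J. grad_sq J s t)) \<le> 2 / h * (u s - u (Suc s))"
      by (simp add: u_def iter_next_epoch)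
  qed
  also have "\<dots> = 2 / h * (\<Sum>s=1..S. u s - u (Suc s))" by (simp only: sum_distrib_left)
  also have "(\<Sum>s=1..S. u s - u (Suc s)) = u 1 - u (Suc S)"
    by (induction S) simp_all
  also have "\<dots> \<le> f w0 - c"
  proof -
    have "c = expect S (\<lambda>_. c)" by simp
    also have "\<dots> \<le> u (Suc S)" unfolding u_def by (intro expect_mono lower)
    finally show ?thesis by (simp add: u_def iter_first)
  qed
  finally show ?thesis using h by (simp add: divide_right_mono mult_left_mono)
qed

text \<open>
  The output index is uniform and independent of the index sets, so it averages over all steps; the law
  of the index sets is replaced by \<open>batches\<close>, since iterates of the first \<open>S\<close> epochs do not see the
  default.
\<close>

lemma expectation_output:
  assumes S: "S \<ge> 1" and m: "m \<ge> 1"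
  shows "measure_pmf.expectation (run_pmf S m n b) (\<lambda>((s, t), J). grad_sq J s t)
           = (\<Sum>s=1..S. \<Sum>t<m. expect S (\<lambda>J. grad_sq J s t)) / (real m * real S)"
proof -
  let ?A = "{1..S} \<times> {1..<m}"
  let ?B = "{1..S} \<times> {..<m}"
  define Q where "Q = Pi_pmf ?A {} (\<lambda>_. pmf_of_set (minibatches n b))"
  define \<sigma> where "\<sigma> J = (\<lambda>k. if k \<in> ?A then J k else {1..b})" for J :: "nat \<times> nat \<Rightarrow> nat set"
  have batches: "batches S = map_pmf \<sigma> Q"
    unfolding batches_def Q_def \<sigma>_def by (rule Pi_pmf_default_swap[symmetric]) simp
  have B: "finite ?B" "?B \<noteq> {}" using S m by (auto simp: lessThan_empty_iff)
  have Q: "finite (set_pmf Q)"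
    by (auto simp: Q_def set_Pi_pmf finite_minibatches minibatches_nonempty)
  have same: "grad_sq J s t = grad_sq (\<sigma> J) s t" if "(s, t) \<in> ?B" for J s t
  proof -
    have "iter J s t = iter (\<sigma> J) s t" using that by (intro iter_cong) (auto simp: \<sigma>_def)
    then show ?thesis by (simp add: grad_sq_def)
  qed
  have "measure_pmf.expectation (run_pmf S m n b) (\<lambda>((s, t), J). grad_sq J s t)
      = (\<Sum>st\<in>?B. pmf (pmf_of_set ?B) st *\<^sub>R
          measure_pmf.expectation (bind_pmf Q (\<lambda>J. return_pmf (st, J))) (\<lambda>((s, t), J). grad_sq J s t))"
    unfolding run_pmf_def pair_pmf_def Q_def[symmetric]
    using B Q by (intro pmf_expectation_bind) auto
  also have "\<dots> = (\<Sum>st\<in>?B. expect S (\<lambda>J. grad_sq J (fst st) (snd st)) / real (card ?B))"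
  proof (rule sum.cong[OF refl])
    fix st assume st: "st \<in> ?B"
    have "measure_pmf.expectation (bind_pmf Q (\<lambda>J. return_pmf (st, J))) (\<lambda>((s, t), J). grad_sq J s t)
        = measure_pmf.expectation Q (\<lambda>J. grad_sq J (fst st) (snd st))"
      by (simp add: case_prod_beta flip: map_pmf_def)
    also have "\<dots> = measure_pmf.expectation Q (\<lambda>J. grad_sq (\<sigma> J) (fst st) (snd st))"
      using same[of "fst st" "snd st"] st by (intro Bochner_Integration.integral_cong refl) simp
    also have "\<dots> = expect S (\<lambda>J. grad_sq J (fst st) (snd st))" by (simp add: batches)
    finally show "pmf (pmf_of_set ?B) st *\<^sub>R
          measure_pmf.expectation (bind_pmf Q (\<lambda>J. return_pmf (st, J))) (\<lambda>((s, t), J). grad_sq J s t)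
        = expect S (\<lambda>J. grad_sq J (fst st) (snd st)) / real (card ?B)"
      using B st by (simp add: pmf_of_set)
  qed
  also have "\<dots> = (\<Sum>s=1..S. \<Sum>t<m. expect S (\<lambda>J. grad_sq J s t)) / (real m * real S)"
    by (simp add: sum.cartesian_product case_prod_beta card_cartesian_product mult.commute
        flip: sum_divide_distrib)
  finally show ?thesis .
qed

end


section \<open>The expected squared gradient of the output\<close>

text \<open>
  Since \<open>L h\<close> and \<open>h r\<close>, with \<open>r\<close> the square root, add up to at most \<open>1\<close>, the square of \<open>h r\<close>
  is at most \<open>h r\<close>, hence at most \<open>1 - L h\<close>, and it dominates \<open>4 \<nu> h\<^sup>2\<close>.
\<close>

lemma step_size_condition:
  fixes h L \<nu> :: real
  assumes h: "0 < h" "h \<le> 1 / (L + sqrt (L\<^sup>2 + 4 * \<nu>))" and L: "0 < L" and \<nu>: "0 \<le> \<nu>"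
  shows "\<nu> / 2 * h\<^sup>2 \<le> 1 - L * h"
proof -
  define r where "r = sqrt (L\<^sup>2 + 4 * \<nu>)"
  have r: "r \<ge> 0" "r\<^sup>2 = L\<^sup>2 + 4 * \<nu>" using \<nu> by (simp_all add: r_def)
  have "h * (L + r) \<le> 1" using h L r(1) by (simp add: r_def[symmetric] pos_le_divide_eq)
  then have hr: "h * r \<le> 1 - L * h" by (simp add: algebra_simps)
  have hr0: "0 \<le> h * r" using h r by simp
  moreover have "0 \<le> L * h" using h L by simp
  ultimately have "(h * r)\<^sup>2 \<le> 1 - L * h"
    using hr mult_mono[of "h * r" "1 - L * h" "h * r" 1] by (simp add: power2_eq_square)
  moreover have "(h * r)\<^sup>2 = L\<^sup>2 * h\<^sup>2 + 4 * (\<nu> * h\<^sup>2)" by (simp add: power_mult_distrib r(2) algebra_simps)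
  moreover have "0 \<le> \<nu> * h\<^sup>2" "0 \<le> L\<^sup>2 * h\<^sup>2" using \<nu> by simp_all
  moreover have "0 \<le> 1 - L * h" using hr0 hr by linarith
  ultimately show ?thesis by linarith
qed

theorem theorem4:
  fixes X :: "('m::{t2_space, second_countable_topology}, 'e::euclidean_space) riem"
    and R :: "'m \<Rightarrow> 'e \<Rightarrow> 'm"
    and T :: "'m \<Rightarrow> 'e \<Rightarrow> 'e \<Rightarrow> 'e"
    and \<Gamma> :: "'m \<Rightarrow> 'm \<Rightarrow> 'e \<Rightarrow> 'e"
    and f :: "'m \<Rightarrow> real"
    and fi :: "nat \<Rightarrow> 'm \<Rightarrow> real"
    and n b m :: nat
    and \<alpha> \<psi> :: "nat \<Rightarrow> nat \<Rightarrow> real"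
    and \<omega> :: "(nat \<times> nat \<Rightarrow> nat set) \<Rightarrow> nat \<Rightarrow> nat \<Rightarrow> 'm"
    and V :: "(nat \<times> nat \<Rightarrow> nat set) \<Rightarrow> nat \<Rightarrow> nat \<Rightarrow> 'e"
    and w0 wstar :: 'm
    and \<Omega> :: "'m set"
    and \<mu> \<rho> M \<theta> L C1 C2 \<delta> N C\<alpha> \<nu> :: real
  assumes manifold: "riemannian_manifold X"
    and retraction: "riemannian_retraction X R"
    and transport: "vector_transport X R T"
    and n: "n \<ge> 1" and b: "1 \<le> b" "b \<le> n" and m: "m \<ge> 1"
    and f: "f = (\<lambda>x. (\<Sum>i=1..n. fi i x) / real n)"
    and minimizer: "\<And>x. f wstar \<le> f x"
    and \<mu>: "0 < \<mu>" "\<mu> < 1"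
    and \<psi>: "\<And>s t. s \<ge> 1 \<Longrightarrow> t < m \<Longrightarrow> 0 \<le> \<psi> s t \<and> \<psi> s t \<le> 1"
    and \<omega>: "\<And>J s t. \<omega> J s t = iterate X R T \<rho> f fi \<alpha> \<mu> \<psi> m w0 J s t"
    and V: "\<And>J s t. V J s t = direction X R T \<rho> f fi \<alpha> \<mu> \<psi> m w0 J s t"
    \<comment> \<open>(i)\<close>
    and C1: "C1_fun X f" "\<And>i. i \<in> {1..n} \<Longrightarrow> C1_fun X (fi i)"
    \<comment> \<open>(ii)\<close>
    and nbhd: "compact \<Omega>" "wstar \<in> interior \<Omega>"
    and in_\<Omega>: "\<And>J s t. J \<in> runs m n b \<Longrightarrow> s \<ge> 1 \<Longrightarrow> t \<le> m \<Longrightarrow> \<omega> J s t \<in> \<Omega>"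
    and \<rho>: "\<rho> > 0" "\<And>x. x \<in> \<Omega> \<Longrightarrow> diffeo_on_tball X R \<rho> x \<and> \<Omega> \<subseteq> R x ` tball X x \<rho>"
    and segment_in_\<Omega>: "\<And>J s t \<tau>. J \<in> runs m n b \<Longrightarrow> s \<ge> 1 \<Longrightarrow> t < m \<Longrightarrow> \<tau> \<in> {0..1} \<Longrightarrow>
           R (\<omega> J s t) (- ((\<tau> * \<alpha> s t) *\<^sub>R V J s t)) \<in> \<Omega>"
    \<comment> \<open>(iii)\<close>
    and isometric: "continuous_transport X R T" "isometric_transport X R T"
    \<comment> \<open>(iv)\<close>
    and \<Gamma>: "parallel_translation_on X \<Omega> \<Gamma>"
    and M: "M > 0" "\<And>x y \<xi>. x \<in> \<Omega> \<Longrightarrow> y \<in> \<Omega> \<Longrightarrow> y = R x \<xi> \<Longrightarrow>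
           (\<Sum>i=1..n. (tnorm X x (grad X (fi i) x - \<Gamma> y x (grad X (fi i) y)))\<^sup>2) / real n
             \<le> M\<^sup>2 * (tnorm X x \<xi>)\<^sup>2"
    \<comment> \<open>(v)\<close>
    and \<theta>: "\<theta> > 0" "\<And>x y \<xi> \<eta>. x \<in> \<Omega> \<Longrightarrow> y \<in> \<Omega> \<Longrightarrow> y = R x \<xi> \<Longrightarrow>
           tnorm X y (\<Gamma> x y \<eta> - T x \<xi> \<eta>) \<le> \<theta> * tnorm X x \<xi> * tnorm X x \<eta>"
    \<comment> \<open>(vi)\<close>
    and L: "L > 0" "\<And>x y \<xi>. x \<in> \<Omega> \<Longrightarrow> y \<in> \<Omega> \<Longrightarrow> y = R x \<xi> \<Longrightarrow>
           f y \<le> f x + metric X x (grad X f x) \<xi> + L / 2 * (tnorm X x \<xi>)\<^sup>2"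
    \<comment> \<open>(vii)\<close>
    and C1C2: "C1 > 0" "C2 > 0" "\<delta> > 0"
         "\<And>x y \<xi>. x \<in> \<Omega> \<Longrightarrow> y \<in> \<Omega> \<Longrightarrow> y = R x \<xi> \<Longrightarrow> tnorm X x \<xi> \<le> \<delta> \<Longrightarrow>
           ennreal (tnorm X x \<xi>) \<le> ennreal C1 * rdist X x y \<and>
           rdist X x y \<le> ennreal (C2 * tnorm X x \<xi>)"
    \<comment> \<open>\<open>\<Omega>\<close> is small enough for (vii) to apply to all \<open>x, y \<in> \<Omega>\<close> with \<open>\<xi> = R\<^sub>x\<^sup>-\<^sup>1 y\<close>; not implied by (i)-(vii)\<close>
    and small_\<Omega>: "\<And>x y. x \<in> \<Omega> \<Longrightarrow> y \<in> \<Omega> \<Longrightarrow> tnorm X x (retr_inv X R \<rho> x y) \<le> \<delta>"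
    and N: "N > 0" "\<And>x i. x \<in> \<Omega> \<Longrightarrow> i \<in> {1..n} \<Longrightarrow> tnorm X x (grad X (fi i) x) \<le> N"
    and \<nu>: "\<nu> = 4 * real m ^ 3 * (M\<^sup>2 + \<theta>\<^sup>2 * N\<^sup>2) * C1\<^sup>2 * C2\<^sup>2"
    and \<alpha>: "\<And>s t. \<alpha> s t = C\<alpha>" "0 < C\<alpha>" "C\<alpha> \<le> 1 / (L + sqrt (L\<^sup>2 + 4 * \<nu>))"
    and \<psi>_summable: "summable (\<lambda>s. \<Sum>t<m. (\<psi> (Suc s) t)\<^sup>2)"
  shows "(\<forall>S\<ge>1.
            measure_pmf.expectation (run_pmf S m n b)
              (\<lambda>((s, t), J). (tnorm X (\<omega> J s t) (grad X f (\<omega> J s t)))\<^sup>2)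
            \<le> 2 / (real m * real S * C\<alpha>)
                  * measure_pmf.expectation (run_pmf S m n b) (\<lambda>_. f w0 - f wstar)
                + 8 * N\<^sup>2 / real S * (\<Sum>s. \<Sum>t<m. (\<psi> (Suc s) t)\<^sup>2))
         \<and> (\<lambda>S. 2 / (real m * real S * C\<alpha>)
                  * measure_pmf.expectation (run_pmf S m n b) (\<lambda>_. f w0 - f wstar)
                + 8 * N\<^sup>2 / real S * (\<Sum>s. \<Sum>t<m. (\<psi> (Suc s) t)\<^sup>2))
           \<in> O(\<lambda>S. 1 / real S)"
proof -
  have \<alpha>_const: "\<alpha> = (\<lambda>_ _. C\<alpha>)" using \<alpha>(1) by (simp add: fun_eq_iff)
  have linear_T: "\<And>x \<eta>. linear (T x \<eta>)" using transport by (simp add: vector_transport_def)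
  interpret svrg: hybrid_svrg X R T \<Gamma> f fi n b m \<psi> w0 \<Omega> \<mu> \<rho> M \<theta> L C1 C2 \<delta> N C\<alpha>
    by (rule hybrid_svrg.intro)
      (use manifold retraction linear_T isometric b f C1 \<mu> \<psi> in_\<Omega> \<rho> segment_in_\<Omega> M \<theta> L C1C2 small_\<Omega> N \<alpha>
        in \<open>simp_all only: \<omega> V \<alpha>_const\<close>)
  have "\<nu> \<ge> 0" by (simp add: \<nu>)
  then have "\<nu> / 2 * C\<alpha>\<^sup>2 \<le> 1 - L * C\<alpha>" by (rule step_size_condition[OF \<alpha>(2,3) L(1)])
  moreover have "svrg.\<kappa> * real m ^ 3 = \<nu> / 2 * C\<alpha>\<^sup>2" by (simp add: svrg.\<kappa>_def \<nu> field_simps)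
  ultimately have step_size: "svrg.\<kappa> * real m ^ 3 \<le> 1 - L * C\<alpha>" by simp
  have \<psi>_sum: "0 \<le> (\<Sum>s. \<Sum>t<m. (\<psi> (Suc s) t)\<^sup>2)"
    by (intro suminf_nonneg[OF \<psi>_summable] sum_nonneg) simp
  have sq: "(\<lambda>((s, t), J). (tnorm X (\<omega> J s t) (grad X f (\<omega> J s t)))\<^sup>2) = (\<lambda>((s, t), J). svrg.grad_sq J s t)"
    by (simp add: svrg.grad_sq_def \<omega> \<alpha>_const)
  have bound: "measure_pmf.expectation (run_pmf S m n b)
        (\<lambda>((s, t), J). (tnorm X (\<omega> J s t) (grad X f (\<omega> J s t)))\<^sup>2)
      \<le> 2 / (real m * real S * C\<alpha>) * (f w0 - f wstar)" if "S \<ge> 1" for S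
  proof -
    have "(\<Sum>s=1..S. \<Sum>t<m. svrg.expect S (\<lambda>J. svrg.grad_sq J s t)) / (real m * real S)
        \<le> 2 / C\<alpha> * (f w0 - f wstar) / (real m * real S)"
      using svrg.total_progress[OF step_size minimizer] by (rule divide_right_mono) simp
    then show ?thesis unfolding sq svrg.expectation_output[OF that m] by (simp add: mult_ac)
  qed
  have "(\<lambda>S. 2 / (real m * real S * C\<alpha>)
                  * measure_pmf.expectation (run_pmf S m n b) (\<lambda>_. f w0 - f wstar)
                + 8 * N\<^sup>2 / real S * (\<Sum>s. \<Sum>t<m. (\<psi> (Suc s) t)\<^sup>2))
      = (\<lambda>S. (2 / (real m * C\<alpha>) * (f w0 - f wstar) + 8 * N\<^sup>2 * (\<Sum>s. \<Sum>t<m. (\<psi> (Suc s) t)\<^sup>2))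
           * (1 / real S))"
    by (simp add: fun_eq_iff divide_inverse distrib_left distrib_right mult_ac)
  moreover have "(\<lambda>S. c * (1 / real S)) \<in> O(\<lambda>S. 1 / real S)" for c :: real
    by (rule bigoI[of _ "\<bar>c\<bar>"]) (simp add: abs_mult)
  ultimately have "(\<lambda>S. 2 / (real m * real S * C\<alpha>)
                  * measure_pmf.expectation (run_pmf S m n b) (\<lambda>_. f w0 - f wstar)
                + 8 * N\<^sup>2 / real S * (\<Sum>s. \<Sum>t<m. (\<psi> (Suc s) t)\<^sup>2)) \<in> O(\<lambda>S. 1 / real S)"
    by (simp only:)
  moreover have "measure_pmf.expectation (run_pmf S m n b)
              (\<lambda>((s, t), J). (tnorm X (\<omega> J s t) (grad X f (\<omega> J s t)))\<^sup>2)
            \<le> 2 / (real m * real S * C\<alpha>)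
                  * measure_pmf.expectation (run_pmf S m n b) (\<lambda>_. f w0 - f wstar)
                + 8 * N\<^sup>2 / real S * (\<Sum>s. \<Sum>t<m. (\<psi> (Suc s) t)\<^sup>2)" if "S \<ge> 1" for S
  proof -
    have "0 \<le> 8 * N\<^sup>2 / real S * (\<Sum>s. \<Sum>t<m. (\<psi> (Suc s) t)\<^sup>2)" using \<psi>_sum by simp
    then show ?thesis using bound[OF that] by simp
  qed
  ultimately show ?thesis by blast
qed

end
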